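(* Let $\Gamma$ be a Coxeter graph with finite vertex set $S$, and let $X \subseteq S$. The natural homomorphism $\mathrm{VA}[\Gamma_X] \to \mathrm{VA}_X[\Gamma]$ that maps $\sigma_x$ to $\sigma_x$ and $\tau_x$ to $\tau_x$ for all $x \in X$ is an isomorphism.
   Context: A Coxeter matrix over a finite set $S$ is a symmetric matrix $M=(m_{s,t})_{s,t\in S}$ with entries in $\mathbb{N}_{\ge 1}\cup\{\infty\}$, such that $m_{s,s}=1$ for all $s$ and $m_{s,t}=m_{t,s}\ge 2$ for all $s\neq t$. Its Coxeter graph $\Gamma$ has vertex set $S$; distinct $s,t$ are joined by an edge iff $m_{s,t}\ge 3$, and the edge is labeled by $m_{s,t}$ if $m_{s,t}\ge 4$. Thus $\Gamma$ and $M$ determine each other. For $X\subseteq S$, $\Gamma_X$ denotes the full Coxeter subgraph spanned by $X$, i.e. the Coxeter graph of $(m_{s,t})_{s,t\in X}$. For letters $a,b$ and an integer $m\geq 1$, $\Pi(a,b,m)$ denotes the alternating product $aba\cdots$ of length $m$. The virtual Artin group $\mathrm{VA}[\Gamma]$ is the group generated by $\mathcal{S}\sqcup\mathcal{T}$, where $\mathcal{S}=\{\sigma_s\mid s\in S\}$ and $\mathcal{T}=\{\tau_s\mid s\in S\}$ are in one-to-one correspondence with $S$, subject to the relations: (v1) $\Pi(\sigma_s,\sigma_t,m_{s,t})=\Pi(\sigma_t,\sigma_s,m_{s,t})$ for $s\ne t$ with $m_{s,t}\ne\infty$; (v2) $\tau_s^2=1$ for $s\in S$, and $\Pi(\tau_s,\tau_t,m_{s,t})=\Pi(\tau_t,\tau_s,m_{s,t})$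 for $s\ne t$ with $m_{s,t}\neq\infty$; (v3) $\sigma_s\,\Pi(\tau_t,\tau_s,m_{s,t}-1)=\Pi(\tau_t,\tau_s,m_{s,t}-1)\,\sigma_r$ for $s\neq t$ with $m_{s,t}\ne\infty$, where $r=s$ if $m_{s,t}$ is even and $r=t$ if $m_{s,t}$ is odd. For $X\subseteq S$, $\mathrm{VA}_X[\Gamma]$ denotes the subgroup of $\mathrm{VA}[\Gamma]$ generated by $\{\sigma_x\mid x\in X\}\sqcup\{\tau_x\mid x\in X\}$ (a standard parabolic subgroup). $\mathrm{VA}[\Gamma_X]$ is the virtual Artin group of the Coxeter graph $\Gamma_X$. *)

theory Defs
  imports "HOL-Algebra.Generated_Groups" "HOL-Library.Extended_Nat"
begin

section \<open>Groups given by generators and relations\<close>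

text \<open>
  The group with generating set \<open>A\<close> and set of relations \<open>R\<close> consists of the words in letters
  \<open>a\<close>, \<open>a\<inverse>\<close> with \<open>a \<in> A\<close>, modulo the smallest congruence that contains free cancellation and \<open>R\<close>.
  A pair \<open>(u, v)\<close> in \<open>R\<close> stands for the relation \<open>u = v\<close>.
\<close>

datatype 'g letter = Pos 'g | Neg 'g

definition group_words :: "'g set \<Rightarrow> 'g letter list set" where
  "group_words A = lists (Pos ` A \<union> Neg ` A)"

inductive_set word_cong ::
    "'g set \<Rightarrow> ('g letter list \<times> 'g letter list) set \<Rightarrow> ('g letter list \<times> 'g letter list) set"
  for A and R where
  rel: "(u, v) \<in> R \<Longrightarrow> (u, v) \<in> word_cong A R"
| cancel_right: "a \<in> A \<Longrightarrow> ([Pos a, Neg a], []) \<in> word_cong A R"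
| cancel_left: "a \<in> A \<Longrightarrow> ([Neg a, Pos a], []) \<in> word_cong A R"
| refl: "u \<in> group_words A \<Longrightarrow> (u, u) \<in> word_cong A R"
| sym: "(u, v) \<in> word_cong A R \<Longrightarrow> (v, u) \<in> word_cong A R"
| trans: "(u, v) \<in> word_cong A R \<Longrightarrow> (v, w) \<in> word_cong A R \<Longrightarrow> (u, w) \<in> word_cong A R"
| append: "(u, u') \<in> word_cong A R \<Longrightarrow> (v, v') \<in> word_cong A R \<Longrightarrow> (u @ v, u' @ v') \<in> word_cong A R"

definition word_class ::
    "'g set \<Rightarrow> ('g letter list \<times> 'g letter list) set \<Rightarrow> 'g letter list \<Rightarrow> 'g letter list set" where
  "word_class A R w = word_cong A R `` {w}"

definition presented_group ::
    "'g set \<Rightarrow> ('g letter list \<times> 'g letter list) set \<Rightarrow> 'g letter list set monoid" where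
  "presented_group A R =
    \<lparr>carrier = group_words A // word_cong A R,
     monoid.mult = (\<lambda>C D. \<Union>u\<in>C. \<Union>v\<in>D. word_class A R (u @ v)),
     one = word_class A R []\<rparr>"

definition presented_gen ::
    "'g set \<Rightarrow> ('g letter list \<times> 'g letter list) set \<Rightarrow> 'g \<Rightarrow> 'g letter list set" where
  "presented_gen A R a = word_class A R [Pos a]"

text \<open>
  The lemmas below confirm that this is the group presented by \<open>A\<close> and \<open>R\<close>: it is a group, it is
  generated by \<open>A\<close>, the relations hold in it, and it has the universal property.
\<close>

lemma group_words_append [simp]: "u @ v \<in> group_words A \<longleftrightarrow> u \<in> group_words A \<and> v \<in> group_words A"
  by (auto simp: group_words_def)

lemma group_words_Nil [simp]: "[] \<in> group_words A"
  by (simp add: group_words_def)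

lemma group_words_Cons [simp]:
  "Pos a # w \<in> group_words A \<longleftrightarrow> a \<in> A \<and> w \<in> group_words A"
  "Neg a # w \<in> group_words A \<longleftrightarrow> a \<in> A \<and> w \<in> group_words A"
  by (auto simp: group_words_def)

lemma word_cong_words:
  assumes "R \<subseteq> group_words A \<times> group_words A" and "(u, v) \<in> word_cong A R"
  shows "u \<in> group_words A \<and> v \<in> group_words A"
  using assms(2) by induction (use assms(1) in auto)

lemma equiv_word_cong:
  assumes "R \<subseteq> group_words A \<times> group_words A"
  shows "equiv (group_words A) (word_cong A R)"
proof (rule equivI)
  show "word_cong A R \<subseteq> group_words A \<times> group_words A"
    using word_cong_words[OF assms] by auto
  show "refl_on (group_words A) (word_cong A R)"
    by (auto simp: refl_on_def intro: word_cong.refl)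
  show "sym (word_cong A R)" by (auto intro: symI word_cong.sym)
  show "trans (word_cong A R)" by (auto intro: transI word_cong.trans)
qed

lemma word_class_eq_iff:
  assumes "R \<subseteq> group_words A \<times> group_words A" and "u \<in> group_words A" and "v \<in> group_words A"
  shows "word_class A R u = word_class A R v \<longleftrightarrow> (u, v) \<in> word_cong A R"
  unfolding word_class_def using eq_equiv_class_iff[OF equiv_word_cong[OF assms(1)] assms(2,3)] .

lemma carrier_presented_group: "carrier (presented_group A R) = word_class A R ` group_words A"
  by (auto simp: presented_group_def quotient_def word_class_def)

lemma one_presented_group: "\<one>\<^bsub>presented_group A R\<^esub> = word_class A R []"
  by (simp add: presented_group_def)

lemma mult_presented_group:
  assumes R: "R \<subseteq> group_words A \<times> group_words A" and u: "u \<in> group_words A" and v: "v \<in> group_words A"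
  shows "word_class A R u \<otimes>\<^bsub>presented_group A R\<^esub> word_class A R v = word_class A R (u @ v)"
proof -
  have "word_class A R (u' @ v') = word_class A R (u @ v)"
    if "u' \<in> word_class A R u" "v' \<in> word_class A R v" for u' v'
  proof -
    have *: "(u, u') \<in> word_cong A R" "(v, v') \<in> word_cong A R"
      using that by (auto simp: word_class_def)
    then have "(u @ v, u' @ v') \<in> word_cong A R"
      by (rule word_cong.append)
    then have "word_class A R (u @ v) = word_class A R (u' @ v')"
      unfolding word_class_def by (rule equiv_class_eq[OF equiv_word_cong[OF R]])
    then show ?thesis ..
  qed
  moreover have "u \<in> word_class A R u" "v \<in> word_class A R v"
    using u v by (auto simp: word_class_def intro: word_cong.refl)
  then have "word_class A R u \<noteq> {}" "word_class A R v \<noteq> {}" by blast+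
  ultimately show ?thesis
    by (simp add: presented_group_def cong: SUP_cong)
qed

fun inverse_letter :: "'g letter \<Rightarrow> 'g letter" where
  "inverse_letter (Pos a) = Neg a"
| "inverse_letter (Neg a) = Pos a"

lemma word_cong_inverse:
  assumes "w \<in> group_words A"
  shows "rev (map inverse_letter w) \<in> group_words A \<and>
    (rev (map inverse_letter w) @ w, []) \<in> word_cong A R"
  using assms
proof (induction w)
  case Nil
  then show ?case by (auto intro: word_cong.refl)
next
  case (Cons x w)
  let ?i = "rev (map inverse_letter w)"
  have w: "w \<in> group_words A" and x: "[inverse_letter x] \<in> group_words A"
    and c: "([inverse_letter x, x], []) \<in> word_cong A R"
    using Cons.prems by (cases x; auto intro: word_cong.cancel_left word_cong.cancel_right)+
  from Cons.IH[OF w] have i: "?i \<in> group_words A" and IH: "(?i @ w, []) \<in> word_cong A R"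
    by auto
  have "(?i @ ([inverse_letter x, x] @ w), ?i @ ([] @ w)) \<in> word_cong A R"
    by (intro word_cong.append word_cong.refl i w c)
  then show ?case
    using i x IH by (auto intro: word_cong.trans)
qed

lemma word_class_in_carrier:
  "w \<in> group_words A \<Longrightarrow> word_class A R w \<in> carrier (presented_group A R)"
  unfolding carrier_presented_group by (rule imageI)

lemma group_presented_group:
  assumes R: "R \<subseteq> group_words A \<times> group_words A"
  shows "group (presented_group A R)" (is "group ?G")
proof (rule groupI)
  have words: "\<exists>w\<in>group_words A. x = word_class A R w" if "x \<in> carrier ?G" for x
    using that by (auto simp: carrier_presented_group)
  note mult = mult_presented_group[OF R]
  show "\<one>\<^bsub>?G\<^esub> \<in> carrier ?G"
    by (simp add: one_presented_group word_class_in_carrier)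
  fix x assume "x \<in> carrier ?G"
  then obtain u where u: "u \<in> group_words A" and x: "x = word_class A R u"
    using words by blast
  show "\<one>\<^bsub>?G\<^esub> \<otimes>\<^bsub>?G\<^esub> x = x"
    by (simp add: x u one_presented_group mult)
  show "\<exists>y\<in>carrier ?G. y \<otimes>\<^bsub>?G\<^esub> x = \<one>\<^bsub>?G\<^esub>"
  proof
    let ?i = "rev (map inverse_letter u)"
    have i: "?i \<in> group_words A" "(?i @ u, []) \<in> word_cong A R"
      using word_cong_inverse[OF u] by blast+
    show "word_class A R ?i \<in> carrier ?G"
      by (rule word_class_in_carrier) (rule i)
    have "word_class A R (?i @ u) = word_class A R []"
      using i u by (subst word_class_eq_iff[OF R]) auto
    then show "word_class A R ?i \<otimes>\<^bsub>?G\<^esub> x = \<one>\<^bsub>?G\<^esub>"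
      unfolding x one_presented_group mult[OF i(1) u] .
  qed
  fix y assume "y \<in> carrier ?G"
  then obtain v where v: "v \<in> group_words A" and y: "y = word_class A R v"
    using words by blast
  show "x \<otimes>\<^bsub>?G\<^esub> y \<in> carrier ?G"
    by (simp add: x y u v mult word_class_in_carrier)
  fix z assume "z \<in> carrier ?G"
  then obtain w where w: "w \<in> group_words A" and z: "z = word_class A R w"
    using words by blast
  show "x \<otimes>\<^bsub>?G\<^esub> y \<otimes>\<^bsub>?G\<^esub> z = x \<otimes>\<^bsub>?G\<^esub> (y \<otimes>\<^bsub>?G\<^esub> z)"
    by (simp add: x y z u v w mult)
qed

lemma presented_gen_in_carrier: "a \<in> A \<Longrightarrow> presented_gen A R a \<in> carrier (presented_group A R)"
  by (simp add: presented_gen_def word_class_in_carrier)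

primrec eval_word :: "('h, 'm) monoid_scheme \<Rightarrow> ('g \<Rightarrow> 'h) \<Rightarrow> 'g letter list \<Rightarrow> 'h" where
  "eval_word G f [] = \<one>\<^bsub>G\<^esub>"
| "eval_word G f (x # w) =
    (case x of Pos a \<Rightarrow> f a | Neg a \<Rightarrow> inv\<^bsub>G\<^esub> f a) \<otimes>\<^bsub>G\<^esub> eval_word G f w"

lemma eval_word_closed:
  assumes "group G" and "f ` A \<subseteq> carrier G" and "w \<in> group_words A"
  shows "eval_word G f w \<in> carrier G"
proof -
  interpret group G by fact
  show ?thesis
    using assms(3)
  proof (induction w)
    case (Cons x w)
    then show ?case using assms(2) by (cases x) auto
  qed simp
qed

lemma eval_word_append:
  assumes "group G" and "f ` A \<subseteq> carrier G" and "u \<in> group_words A" and "v \<in> group_words A"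
  shows "eval_word G f (u @ v) = eval_word G f u \<otimes>\<^bsub>G\<^esub> eval_word G f v"
proof -
  interpret group G by fact
  show ?thesis
    using assms(3)
  proof (induction u)
    case Nil
    then show ?case using eval_word_closed[OF assms(1,2,4)] by simp
  next
    case (Cons x u)
    then show ?case
      using assms(2) eval_word_closed[OF assms(1,2,4)] eval_word_closed[OF assms(1,2), of u]
      by (cases x) (auto simp: m_assoc)
  qed
qed

lemma eval_presented_gen:
  assumes R: "R \<subseteq> group_words A \<times> group_words A" and "w \<in> group_words A"
  shows "eval_word (presented_group A R) (presented_gen A R) w = word_class A R w"
proof -
  interpret group "presented_group A R" by (rule group_presented_group[OF R])
  have inv: "inv\<^bsub>presented_group A R\<^esub> presented_gen A R a = word_class A R [Neg a]" if "a \<in> A" for a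
  proof (rule inv_equality)
    have "word_class A R [Neg a, Pos a] = word_class A R []"
      using that word_cong.cancel_left[OF that, of R] by (subst word_class_eq_iff[OF R]) simp_all
    then show "word_class A R [Neg a] \<otimes>\<^bsub>presented_group A R\<^esub> presented_gen A R a
      = \<one>\<^bsub>presented_group A R\<^esub>"
      using that by (simp add: presented_gen_def one_presented_group mult_presented_group[OF R])
    show "presented_gen A R a \<in> carrier (presented_group A R)"
      using that by (rule presented_gen_in_carrier)
    show "word_class A R [Neg a] \<in> carrier (presented_group A R)"
      by (rule word_class_in_carrier) (simp add: that)
  qed
  show ?thesis
    using assms(2)
  proof (induction w)
    case Nil
    then show ?case by (simp add: one_presented_group)
  next
    case (Cons x w)
    then show ?case
      by (cases x) (simp_all add: inv, simp_all add: presented_gen_def mult_presented_group[OF R])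
  qed
qed

lemma presented_group_relation:
  assumes R: "R \<subseteq> group_words A \<times> group_words A" and uv: "(u, v) \<in> R"
  shows "eval_word (presented_group A R) (presented_gen A R) u =
    eval_word (presented_group A R) (presented_gen A R) v"
proof -
  have "u \<in> group_words A" "v \<in> group_words A"
    using R uv by auto
  then show ?thesis
    using word_cong.rel[OF uv] by (simp add: eval_presented_gen[OF R] word_class_eq_iff[OF R])
qed

lemma presented_group_generated:
  assumes R: "R \<subseteq> group_words A \<times> group_words A"
  shows "generate (presented_group A R) (presented_gen A R ` A) = carrier (presented_group A R)"
proof
  interpret group "presented_group A R" by (rule group_presented_group[OF R])
  show "generate (presented_group A R) (presented_gen A R ` A) \<subseteq> carrier (presented_group A R)"
    by (rule generate_incl) (auto simp: presented_gen_in_carrier)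
  have "eval_word (presented_group A R) (presented_gen A R) w
      \<in> generate (presented_group A R) (presented_gen A R ` A)" if "w \<in> group_words A" for w
    using that
  proof (induction w)
    case Nil
    then show ?case by (simp add: generate.one)
  next
    case (Cons x w)
    then show ?case
      by (cases x) (auto intro!: generate.eng intro: generate.incl generate.inv)
  qed
  then show "carrier (presented_group A R) \<subseteq> generate (presented_group A R) (presented_gen A R ` A)"
    by (auto simp: carrier_presented_group eval_presented_gen[OF R])
qed

lemma presented_group_universal:
  assumes R: "R \<subseteq> group_words A \<times> group_words A" and G: "group G" and f: "f ` A \<subseteq> carrier G"
    and holds: "\<And>u v. (u, v) \<in> R \<Longrightarrow> eval_word G f u = eval_word G f v"
  shows "\<exists>h \<in> hom (presented_group A R) G. \<forall>a\<in>A. h (presented_gen A R a) = f a"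
proof -
  interpret group G by fact
  have cong: "eval_word G f u = eval_word G f v" if "(u, v) \<in> word_cong A R" for u v
    using that
  proof induction
    case (rel u v)
    then show ?case by (rule holds)
  next
    case (append u u' v v')
    then have "u \<in> group_words A" "u' \<in> group_words A" "v \<in> group_words A" "v' \<in> group_words A"
      using word_cong_words[OF R] by blast+
    then show ?case
      using append.IH by (simp add: eval_word_append[OF G f])
  next
    case (cancel_right a)
    then have "f a \<in> carrier G" using f by blast
    then show ?case by simp
  next
    case (cancel_left a)
    then have "f a \<in> carrier G" using f by blast
    then show ?case by simp
  qed simp_all
  define h where "h C = eval_word G f (SOME w. w \<in> C)" for C
  have h: "h (word_class A R w) = eval_word G f w" if "w \<in> group_words A" for w
  proof -
    have "w \<in> word_class A R w"
      using that by (auto simp: word_class_def intro: word_cong.refl)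
    then have "(SOME v. v \<in> word_class A R w) \<in> word_class A R w" by (rule someI)
    then have "(w, SOME v. v \<in> word_class A R w) \<in> word_cong A R" by (simp add: word_class_def)
    then show ?thesis
      using cong by (simp add: h_def)
  qed
  have "h \<in> hom (presented_group A R) G"
  proof (rule homI)
    fix x assume "x \<in> carrier (presented_group A R)"
    then obtain u where u: "u \<in> group_words A" and x: "x = word_class A R u"
      unfolding carrier_presented_group by blast
    show "h x \<in> carrier G"
      by (simp add: x u h eval_word_closed[OF G f])
    fix y assume "y \<in> carrier (presented_group A R)"
    then obtain v where v: "v \<in> group_words A" and y: "y = word_class A R v"
      unfolding carrier_presented_group by blast
    show "h (x \<otimes>\<^bsub>presented_group A R\<^esub> y) = h x \<otimes>\<^bsub>G\<^esub> h y"
      by (simp add: x u y v h mult_presented_group[OF R] eval_word_append[OF G f])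
  qed
  moreover have "h (presented_gen A R a) = f a" if "a \<in> A" for a
  proof -
    have "f a \<in> carrier G" using that f by blast
    then show ?thesis using that by (simp add: presented_gen_def h)
  qed
  ultimately show ?thesis by blast
qed


section \<open>Coxeter graphs\<close>

text \<open>
  A Coxeter graph and its Coxeter matrix determine each other, so a Coxeter graph is represented
  by its vertex set together with its Coxeter matrix. Matrix entries outside of the
  vertex set carry no information. Two distinct vertices \<open>s\<close>, \<open>t\<close> are adjacent if and only if
  \<open>cox_m \<Gamma> s t \<ge> 3\<close>, the label of the edge being \<open>cox_m \<Gamma> s t\<close> if this is at least \<open>4\<close>.
\<close>

record 's coxeter_graph =
  vertices :: "'s set"
  cox_m :: "'s \<Rightarrow> 's \<Rightarrow> enat"

definition is_coxeter_graph :: "'s coxeter_graph \<Rightarrow> bool" where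
  "is_coxeter_graph \<Gamma> \<longleftrightarrow>
    finite (vertices \<Gamma>) \<and>
    (\<forall>s\<in>vertices \<Gamma>. cox_m \<Gamma> s s = 1) \<and>
    (\<forall>s\<in>vertices \<Gamma>. \<forall>t\<in>vertices \<Gamma>. s \<noteq> t \<longrightarrow> cox_m \<Gamma> s t = cox_m \<Gamma> t s \<and> 2 \<le> cox_m \<Gamma> s t)"

definition full_subgraph :: "'s coxeter_graph \<Rightarrow> 's set \<Rightarrow> 's coxeter_graph" where
  "full_subgraph \<Gamma> X = \<lparr>vertices = X, cox_m = cox_m \<Gamma>\<rparr>"


section \<open>Virtual Artin groups\<close>

datatype 's va_gen = SigmaGen 's | TauGen 's

primrec alternating :: "'a \<Rightarrow> 'a \<Rightarrow> nat \<Rightarrow> 'a list" where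
  "alternating a b 0 = []"
| "alternating a b (Suc n) = a # alternating b a n"

definition va_gens :: "'s coxeter_graph \<Rightarrow> 's va_gen set" where
  "va_gens \<Gamma> = SigmaGen ` vertices \<Gamma> \<union> TauGen ` vertices \<Gamma>"

text \<open>
  All defining relations are between words in the generators themselves. In all rules but \<open>v2_square\<close>,
  the premise \<open>cox_m \<Gamma> s t = enat k\<close> says that \<open>k\<close> is the entry of the Coxeter matrix and that
  this entry is finite.
\<close>

inductive_set va_relations :: "'s coxeter_graph \<Rightarrow> ('s va_gen list \<times> 's va_gen list) set"
  for \<Gamma> where
  v1: "\<lbrakk>s \<in> vertices \<Gamma>; t \<in> vertices \<Gamma>; s \<noteq> t; cox_m \<Gamma> s t = enat k\<rbrakk> \<Longrightarrow>
    (alternating (SigmaGen s) (SigmaGen t) k, alternating (SigmaGen t) (SigmaGen s) k) \<in> va_relations \<Gamma>"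
| v2_square: "s \<in> vertices \<Gamma> \<Longrightarrow> ([TauGen s, TauGen s], []) \<in> va_relations \<Gamma>"
| v2_braid: "\<lbrakk>s \<in> vertices \<Gamma>; t \<in> vertices \<Gamma>; s \<noteq> t; cox_m \<Gamma> s t = enat k\<rbrakk> \<Longrightarrow>
    (alternating (TauGen s) (TauGen t) k, alternating (TauGen t) (TauGen s) k) \<in> va_relations \<Gamma>"
| v3: "\<lbrakk>s \<in> vertices \<Gamma>; t \<in> vertices \<Gamma>; s \<noteq> t; cox_m \<Gamma> s t = enat k; r = (if even k then s else t)\<rbrakk> \<Longrightarrow>
    ([SigmaGen s] @ alternating (TauGen t) (TauGen s) (k - 1),
     alternating (TauGen t) (TauGen s) (k - 1) @ [SigmaGen r]) \<in> va_relations \<Gamma>"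

definition va_rels :: "'s coxeter_graph \<Rightarrow> ('s va_gen letter list \<times> 's va_gen letter list) set" where
  "va_rels \<Gamma> = map_prod (map Pos) (map Pos) ` va_relations \<Gamma>"

definition VA :: "'s coxeter_graph \<Rightarrow> 's va_gen letter list set monoid" where
  "VA \<Gamma> = presented_group (va_gens \<Gamma>) (va_rels \<Gamma>)"

definition va_sigma :: "'s coxeter_graph \<Rightarrow> 's \<Rightarrow> 's va_gen letter list set" where
  "va_sigma \<Gamma> s = presented_gen (va_gens \<Gamma>) (va_rels \<Gamma>) (SigmaGen s)"

definition va_tau :: "'s coxeter_graph \<Rightarrow> 's \<Rightarrow> 's va_gen letter list set" where
  "va_tau \<Gamma> s = presented_gen (va_gens \<Gamma>) (va_rels \<Gamma>) (TauGen s)"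

definition VA_parabolic :: "'s coxeter_graph \<Rightarrow> 's set \<Rightarrow> 's va_gen letter list set monoid" where
  "VA_parabolic \<Gamma> X = subgroup_generated (VA \<Gamma>) (va_sigma \<Gamma> ` X \<union> va_tau \<Gamma> ` X)"

definition is_natural_hom ::
    "'s coxeter_graph \<Rightarrow> 's set \<Rightarrow> ('s va_gen letter list set \<Rightarrow> 's va_gen letter list set) \<Rightarrow> bool" where
  "is_natural_hom \<Gamma> X h \<longleftrightarrow>
    h \<in> hom (VA (full_subgraph \<Gamma> X)) (VA_parabolic \<Gamma> X) \<and>
    (\<forall>x\<in>X. h (va_sigma (full_subgraph \<Gamma> X) x) = va_sigma \<Gamma> x \<and>
           h (va_tau (full_subgraph \<Gamma> X) x) = va_tau \<Gamma> x)"

lemma set_alternating: "set (alternating a b n) \<subseteq> {a, b}"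
  by (induction n arbitrary: a b) auto

lemma va_rels_words: "va_rels \<Gamma> \<subseteq> group_words (va_gens \<Gamma>) \<times> group_words (va_gens \<Gamma>)"
proof -
  have "set u \<subseteq> va_gens \<Gamma> \<and> set v \<subseteq> va_gens \<Gamma>" if "(u, v) \<in> va_relations \<Gamma>" for u v
    using that
    by induction (use set_alternating in \<open>fastforce simp: va_gens_def split: if_splits\<close>)+
  then show ?thesis
    by (fastforce simp: va_rels_def group_words_def in_lists_conv_set)
qed

lemma group_VA: "group (VA \<Gamma>)"
  unfolding VA_def by (rule group_presented_group[OF va_rels_words])

lemma va_sigma_in_VA: "s \<in> vertices \<Gamma> \<Longrightarrow> va_sigma \<Gamma> s \<in> carrier (VA \<Gamma>)"
  unfolding va_sigma_def VA_def by (rule presented_gen_in_carrier) (simp add: va_gens_def)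

lemma va_tau_in_VA: "s \<in> vertices \<Gamma> \<Longrightarrow> va_tau \<Gamma> s \<in> carrier (VA \<Gamma>)"
  unfolding va_tau_def VA_def by (rule presented_gen_in_carrier) (simp add: va_gens_def)

lemma carrier_VA_parabolic:
  assumes "X \<subseteq> vertices \<Gamma>"
  shows "carrier (VA_parabolic \<Gamma> X) = generate (VA \<Gamma>) (va_sigma \<Gamma> ` X \<union> va_tau \<Gamma> ` X)"
proof -
  have "carrier (VA \<Gamma>) \<inter> (va_sigma \<Gamma> ` X \<union> va_tau \<Gamma> ` X) = va_sigma \<Gamma> ` X \<union> va_tau \<Gamma> ` X"
    using assms va_sigma_in_VA[of _ \<Gamma>] va_tau_in_VA[of _ \<Gamma>] by blast
  then show ?thesis
    by (simp add: VA_parabolic_def carrier_subgroup_generated)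
qed

end

theory Submission
  imports Defs Complex_Main
begin

text \<open>
  Write \<open>G\<close> for \<open>VA[\<Gamma>\<^sub>X]\<close>. The words of \<open>VA[\<Gamma>]\<close> act from the right on a set of triples \<open>(a, c, w)\<close>
  with \<open>a \<in> G\<close>, in such a way that a word over \<open>X\<close>, applied to the base triple, leads to a triple
  \<open>(a, base, u)\<close> from which the value \<open>a \<cdot> \<tau>\<^sub>u\<close> of this word in \<open>G\<close> can be read off; this gives injectivity.

  The component \<open>w\<close> is an element of the Coxeter group of \<open>\<Gamma>\<close>, which \<open>\<tau>\<^sub>s\<close> multiplies by \<open>s\<close>, while
  \<open>\<sigma>\<^sub>s\<close> acts on \<open>(a, c)\<close> as the root \<open>w \<alpha>\<^sub>s\<close>. The kernel of \<open>\<sigma>\<^sub>s \<mapsto> 1\<close>, \<open>\<tau>\<^sub>s \<mapsto> s\<close> is an Artin group whose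
  generators are the roots; its Coxeter matrix takes the value \<open>m\<^sub>s\<^sub>t\<close> at \<open>(w \<alpha>\<^sub>s, w \<alpha>\<^sub>t)\<close> and \<open>\<infinity>\<close> elsewhere.
  For every Coxeter matrix on a set \<open>I\<close> and every \<open>J \<subseteq> I\<close>, the Artin group of \<open>I\<close> acts on pairs
  of an element \<open>a\<close> and a minimal representative \<open>c\<close> of a coset in \<open>W\<^sub>J\<setminus>W\<close>: the generator \<open>s\<close> emits the
  generator \<open>x \<in> J\<close> onto \<open>a\<close> if \<open>c \<alpha>\<^sub>s = \<alpha>\<^sub>x\<close>, and replaces \<open>c\<close> by \<open>c s\<close> otherwise. This is
  applied to the roots of \<open>\<Gamma>\<close> and the subset of the roots of \<open>\<Gamma>\<^sub>X\<close>, the emitted elements being the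
  conjugates \<open>\<tau>\<^sub>u \<sigma>\<^sub>x \<tau>\<^sub>u\<inverse>\<close>. That these depend only on the root \<open>u \<alpha>\<^sub>x\<close>, and that \<open>u\<close> determines \<open>\<tau>\<^sub>u\<close>,
  follows from the geometric representation, where every root is nonnegative or nonpositive.
\<close>

section \<open>The geometric representation\<close>

definition basis :: "'i \<Rightarrow> 'i \<Rightarrow> real" where
  "basis s = (\<lambda>q. if q = s then 1 else 0)"

definition fin_supp :: "('i \<Rightarrow> real) \<Rightarrow> bool" where
  "fin_supp v \<longleftrightarrow> finite {q. v q \<noteq> 0}"

definition lincomb :: "real \<Rightarrow> ('i \<Rightarrow> real) \<Rightarrow> real \<Rightarrow> ('i \<Rightarrow> real) \<Rightarrow> 'i \<Rightarrow> real" where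
  "lincomb a u b v = (\<lambda>q. a * u q + b * v q)"

definition supported :: "'i set \<Rightarrow> ('i \<Rightarrow> real) \<Rightarrow> bool" where
  "supported J v \<longleftrightarrow> (\<forall>q. v q \<noteq> 0 \<longrightarrow> q \<in> J)"

definition nonneg :: "('i \<Rightarrow> real) \<Rightarrow> bool" where
  "nonneg v \<longleftrightarrow> (\<forall>q. 0 \<le> v q)"

lemma supp_basis [simp]: "{q. basis s q \<noteq> 0} = {s}"
  by (auto simp: basis_def)

lemma fin_supp_basis [simp]: "fin_supp (basis s)"
  by (simp add: fin_supp_def)

lemma basis_inject [simp]: "basis s = basis t \<longleftrightarrow> s = t"
  by (auto simp: basis_def fun_eq_iff split: if_splits)

lemma fin_supp_lincomb [simp]:
  assumes "fin_supp u" "fin_supp v"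
  shows "fin_supp (lincomb a u b v)"
proof -
  have "{q. lincomb a u b v q \<noteq> 0} \<subseteq> {q. u q \<noteq> 0} \<union> {q. v q \<noteq> 0}"
    by (auto simp: lincomb_def)
  then show ?thesis
    using assms finite_subset unfolding fin_supp_def by blast
qed

lemma supported_basis [simp]: "supported J (basis s) \<longleftrightarrow> s \<in> J"
  by (auto simp: supported_def basis_def)

lemma supported_lincomb:
  "supported J u \<Longrightarrow> supported J v \<Longrightarrow> supported J (lincomb a u b v)"
  unfolding supported_def lincomb_def by (metis add_0 mult_zero_right)

lemma nonneg_basis [simp]: "nonneg (basis s)"
  by (simp add: nonneg_def basis_def)

lemma nonneg_lincomb:
  "nonneg u \<Longrightarrow> nonneg v \<Longrightarrow> 0 \<le> a \<Longrightarrow> 0 \<le> b \<Longrightarrow> nonneg (lincomb a u b v)"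
  by (simp add: nonneg_def lincomb_def)

lemma lincomb_zero [simp]: "lincomb 1 u 0 v = u" "lincomb 0 u 1 v = v"
  by (simp_all add: lincomb_def)

section \<open>Alternating words\<close>

lemma alternating_append:
  "alternating s t (i + j) =
    alternating s t i @ (if even i then alternating s t j else alternating t s j)"
  by (induction i arbitrary: s t) auto

lemma length_alternating [simp]: "length (alternating s t k) = k"
  by (induction k arbitrary: s t) auto

lemma alternating_Suc_right:
  "alternating s t (Suc k) = alternating s t k @ [if even k then s else t]"
  using alternating_append[of s t k 1] by auto

lemma rev_alternating:
  "rev (alternating s t k) = (if even k then alternating t s k else alternating s t k)"
proof (induction k arbitrary: s t)
  case (Suc k)
  have "rev (alternating s t (Suc k)) = rev (alternating t s k) @ [s]"
    by simp
  also have "\<dots> = (if even (Suc k) then alternating t s (Suc k) else alternating s t (Suc k))"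
    by (simp only: Suc alternating_Suc_right) auto
  finally show ?case .
qed simp

lemma map_alternating: "map f (alternating s t k) = alternating (f s) (f t) k"
  by (induction k arbitrary: s t) auto

lemma distinct_adj_alternating:
  assumes "set w \<subseteq> {s, t}" "distinct_adj w" "w \<noteq> [] \<Longrightarrow> hd w = s"
  shows "w = alternating s t (length w)"
  using assms
proof (induction w arbitrary: s t)
  case (Cons a w)
  have "w = alternating t s (length w)"
    using Cons.prems by (intro Cons.IH) (auto simp: distinct_adj_Cons dest: hd_in_set)
  then show ?case using Cons.prems by simp
qed simp

text \<open>In the usual indexing, \<open>chebyshev x k\<close> is \<open>U\<^sub>k\<^sub>-\<^sub>1(x / 2)\<close>.\<close>

fun chebyshev :: "real \<Rightarrow> nat \<Rightarrow> real" where
  "chebyshev x 0 = 0"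
| "chebyshev x (Suc 0) = 1"
| "chebyshev x (Suc (Suc k)) = x * chebyshev x (Suc k) - chebyshev x k"

lemma chebyshev_two: "chebyshev 2 k = real k"
  by (induction "2::real" k rule: chebyshev.induct) auto

lemma chebyshev_sin: "chebyshev (2 * cos \<theta>) k * sin \<theta> = sin (real k * \<theta>)"
proof (induction "2 * cos \<theta>" k rule: chebyshev.induct)
  case (3 k)
  have "sin (real (Suc (Suc k)) * \<theta>) = sin (real (Suc k) * \<theta> + \<theta>)"
    "sin (real k * \<theta>) = sin (real (Suc k) * \<theta> - \<theta>)"
    by (simp_all add: algebra_simps)
  then have "sin (real (Suc (Suc k)) * \<theta>) = 2 * cos \<theta> * sin (real (Suc k) * \<theta>) - sin (real k * \<theta>)"
    by (simp add: sin_add sin_diff)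
  then show ?case
    using 3 by (simp add: algebra_simps)
qed auto

text \<open>The recursion has determinant 1, so the left side does not change with \<open>i\<close>.
  It is the determinant of the coefficients of two dihedral roots and will decide their linear
  independence.\<close>

lemma chebyshev_det:
  "chebyshev x (Suc i) * chebyshev x (i + k) - chebyshev x i * chebyshev x (Suc (i + k)) = chebyshev x k"
proof (induction i)
  case (Suc i)
  then show ?case by (simp add: algebra_simps)
qed simp

lemma sin_pi_div_pos: "2 \<le> m \<Longrightarrow> 0 < k \<Longrightarrow> k < m \<Longrightarrow> 0 < sin (real k * (pi / real m))"
  by (rule sin_gt_zero) (auto simp: field_simps)

lemma chebyshev_pos:
  assumes "2 \<le> m" "0 < k" "k < m"
  shows "0 < chebyshev (2 * cos (pi / real m)) k"
proof -
  have "0 < chebyshev (2 * cos (pi / real m)) k * sin (pi / real m)"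
    unfolding chebyshev_sin by (rule sin_pi_div_pos) (use assms in auto)
  moreover have "0 < sin (pi / real m)"
    using sin_pi_div_pos[of m 1] assms by simp
  ultimately show ?thesis
    by (simp add: zero_less_mult_iff)
qed

lemma chebyshev_reflect:
  assumes "2 \<le> m" "k \<le> m"
  shows "chebyshev (2 * cos (pi / real m)) (m - k) = chebyshev (2 * cos (pi / real m)) k"
proof -
  have "real (m - k) * (pi / real m) = pi - real k * (pi / real m)"
    using assms by (simp add: of_nat_diff field_simps)
  then have "chebyshev (2 * cos (pi / real m)) (m - k) * sin (pi / real m)
      = chebyshev (2 * cos (pi / real m)) k * sin (pi / real m)"
    unfolding chebyshev_sin by (simp add: sin_diff)
  moreover have "0 < sin (pi / real m)"
    using sin_pi_div_pos[of m 1] assms by simp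
  ultimately show ?thesis by simp
qed

section \<open>Invariant form and reflections\<close>

locale coxeter_matrix =
  fixes N :: "'i \<Rightarrow> 'i \<Rightarrow> enat"
  assumes N_diag: "N s s = 1"
    and N_sym: "N s t = N t s"
    and N_ge_2: "s \<noteq> t \<Longrightarrow> 2 \<le> N s t"
begin

text \<open>The diagonal is included: \<open>N s s = 1\<close> gives - cos pi = 1. At an infinite
  entry the value is the limit of the finite ones.\<close>

definition gram :: "'i \<Rightarrow> 'i \<Rightarrow> real" where
  "gram s t = (case N s t of enat k \<Rightarrow> - cos (pi / real k) | \<infinity> \<Rightarrow> - 1)"

text \<open>The sums run over supports because the index type may be infinite: the locale is later
  applied with vectors as indices.\<close>

definition form :: "('i \<Rightarrow> real) \<Rightarrow> ('i \<Rightarrow> real) \<Rightarrow> real" where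
  "form u v = (\<Sum>s | u s \<noteq> 0. \<Sum>t | v t \<noteq> 0. u s * v t * gram s t)"

definition reflection :: "('i \<Rightarrow> real) \<Rightarrow> ('i \<Rightarrow> real) \<Rightarrow> 'i \<Rightarrow> real" where
  "reflection b v = lincomb 1 v (- 2 * form b v) b"

definition act :: "'i list \<Rightarrow> ('i \<Rightarrow> real) \<Rightarrow> 'i \<Rightarrow> real" where
  "act w = foldr (\<lambda>s. reflection (basis s)) w"

lemma gram_sym: "gram s t = gram t s"
  by (simp add: gram_def N_sym)

lemma gram_self [simp]: "gram s s = 1"
  by (simp add: gram_def N_diag one_enat_def)

lemma form_superset:
  assumes "finite A" "finite B" "{s. u s \<noteq> 0} \<subseteq> A" "{t. v t \<noteq> 0} \<subseteq> B"
  shows "form u v = (\<Sum>s\<in>A. \<Sum>t\<in>B. u s * v t * gram s t)"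
proof -
  have "form u v = (\<Sum>s | u s \<noteq> 0. \<Sum>t\<in>B. u s * v t * gram s t)"
    unfolding form_def by (rule sum.cong) (use assms in \<open>auto intro!: sum.mono_neutral_left\<close>)
  also have "\<dots> = (\<Sum>s\<in>A. \<Sum>t\<in>B. u s * v t * gram s t)"
    by (rule sum.mono_neutral_left) (use assms in auto)
  finally show ?thesis .
qed

lemma form_lincomb_right:
  assumes "fin_supp w" "fin_supp u" "fin_supp v"
  shows "form w (lincomb a u b v) = a * form w u + b * form w v"
proof -
  let ?A = "{q. w q \<noteq> 0}" and ?B = "{q. u q \<noteq> 0} \<union> {q. v q \<noteq> 0}"
  have fin: "finite ?A" "finite ?B"
    using assms by (auto simp: fin_supp_def)
  have "form w z = (\<Sum>s\<in>?A. \<Sum>t\<in>?B. w s * z t * gram s t)"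
    if "z = u \<or> z = v \<or> z = lincomb a u b v" for z
    by (rule form_superset) (use that fin in \<open>auto simp: lincomb_def\<close>)
  then show ?thesis
    by (simp add: lincomb_def algebra_simps sum.distrib sum_distrib_left)
qed

lemma form_sym: "form u v = form v u"
  unfolding form_def
  by (subst sum.swap) (simp add: gram_sym mult.commute)

lemma form_lincomb_left:
  assumes "fin_supp w" "fin_supp u" "fin_supp v"
  shows "form (lincomb a u b v) w = a * form u w + b * form v w"
  using form_lincomb_right[OF assms] by (simp add: form_sym)

lemma form_basis [simp]: "form (basis s) (basis t) = gram s t"
  by (simp add: form_def basis_def)

lemma fin_supp_reflection [simp]: "fin_supp b \<Longrightarrow> fin_supp v \<Longrightarrow> fin_supp (reflection b v)"
  by (simp add: reflection_def)

lemma reflection_lincomb: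
  "fin_supp b \<Longrightarrow> fin_supp u \<Longrightarrow> fin_supp v \<Longrightarrow>
    reflection b (lincomb x u y v) = lincomb x (reflection b u) y (reflection b v)"
  by (simp add: reflection_def form_lincomb_right) (auto simp: lincomb_def algebra_simps)

lemma form_reflection:
  assumes "fin_supp b" "fin_supp u" "fin_supp v" "form b b = 1"
  shows "form (reflection b u) (reflection b v) = form u v"
  using assms
  by (simp add: reflection_def form_lincomb_left form_lincomb_right form_sym[of u b] algebra_simps)

lemma reflection_reflection:
  assumes "fin_supp b" "fin_supp v" "form b b = 1"
  shows "reflection b (reflection b v) = v"
  using assms by (simp add: reflection_def form_lincomb_right) (simp add: lincomb_def)

lemma act_Nil [simp]: "act [] v = v"
  by (simp add: act_def)

lemma act_Cons: "act (s # w) v = reflection (basis s) (act w v)"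
  by (simp add: act_def)

lemma act_append: "act (u @ w) v = act u (act w v)"
  by (simp add: act_def)

lemma fin_supp_act [simp]: "fin_supp v \<Longrightarrow> fin_supp (act w v)"
  by (induction w) (auto simp: act_Cons)

lemma act_lincomb:
  "fin_supp u \<Longrightarrow> fin_supp v \<Longrightarrow> act w (lincomb a u b v) = lincomb a (act w u) b (act w v)"
  by (induction w) (auto simp: act_Cons reflection_lincomb)

lemma form_act: "fin_supp u \<Longrightarrow> fin_supp v \<Longrightarrow> form (act w u) (act w v) = form u v"
  by (induction w) (auto simp: act_Cons form_reflection)

lemma act_double: "fin_supp v \<Longrightarrow> act [s, s] v = v"
  by (simp add: act_Cons reflection_reflection)

lemma act_rev: "fin_supp v \<Longrightarrow> act (rev w) (act w v) = v"
  by (induction w) (auto simp: act_Cons act_append reflection_reflection)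

lemma act_rev': "fin_supp v \<Longrightarrow> act w (act (rev w) v) = v"
  using act_rev[of v "rev w"] by simp

lemma act_inj: "fin_supp u \<Longrightarrow> fin_supp v \<Longrightarrow> act w u = act w v \<Longrightarrow> u = v"
  by (metis act_rev)

lemma act_snoc_basis:
  "act (w @ [s]) (basis t) = lincomb 1 (act w (basis t)) (- 2 * gram s t) (act w (basis s))"
  by (simp add: act_append act_Cons reflection_def act_lincomb)

lemma act_snoc_self: "act (w @ [s]) (basis s) = (\<lambda>q. - act w (basis s) q)"
  by (simp add: act_snoc_basis) (simp add: lincomb_def)

lemma act_reflection:
  assumes "fin_supp b" "fin_supp v"
  shows "act w (reflection b v) = reflection (act w b) (act w v)"
  using assms by (simp add: reflection_def act_lincomb form_act)

lemma act_expand: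
  assumes "finite A" "{t. v t \<noteq> 0} \<subseteq> A"
  shows "act w v q = (\<Sum>t\<in>A. v t * act w (basis t) q)"
  using assms
proof (induction A arbitrary: v rule: finite_induct)
  case empty
  then have v: "v = lincomb 0 (basis q) 0 (basis q)"
    by (auto simp: lincomb_def)
  show ?case by (subst v) (simp add: act_lincomb, simp add: lincomb_def)
next
  case (insert a A)
  let ?v = "v(a := 0)"
  have fin: "fin_supp ?v"
    unfolding fin_supp_def by (rule finite_subset[OF _ insert.hyps(1)]) (use insert.prems in auto)
  have v: "v = lincomb 1 ?v (v a) (basis a)"
    by (auto simp: lincomb_def basis_def)
  have "act w v q = act w ?v q + v a * act w (basis a) q"
    by (subst v) (use fin in \<open>simp add: act_lincomb, simp add: lincomb_def\<close>)
  also have "act w ?v q = (\<Sum>t\<in>A. ?v t * act w (basis t) q)"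
    by (rule insert.IH) (use insert.prems in auto)
  also have "\<dots> = (\<Sum>t\<in>A. v t * act w (basis t) q)"
    by (rule sum.cong) (use insert.hyps in auto)
  finally show ?case using insert.hyps by simp
qed

section \<open>Roots of rank two subgroups\<close>

definition dihedral_coeff :: "'i \<Rightarrow> 'i \<Rightarrow> nat \<Rightarrow> real" where
  "dihedral_coeff s t = chebyshev (- 2 * gram s t)"

lemma dihedral_coeff_sym: "dihedral_coeff s t = dihedral_coeff t s"
  by (simp add: dihedral_coeff_def gram_sym)

lemma dihedral_coeff_simps [simp]:
  "dihedral_coeff s t 0 = 0" "dihedral_coeff s t (Suc 0) = 1"
  by (simp_all add: dihedral_coeff_def)

text \<open>The coefficients are sin(k pi / m) / sin(pi / m) if m = \<open>N s t\<close> is finite,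
  and k if it is infinite.\<close>

lemma dihedral_coeff_pos:
  assumes "s \<noteq> t" "0 < k" "enat k < N s t"
  shows "0 < dihedral_coeff s t k"
proof (cases "N s t")
  case (enat m)
  then have "2 \<le> m" using N_ge_2[OF assms(1)] by (simp add: numeral_eq_enat)
  then show ?thesis
    using enat assms chebyshev_pos[of m k] by (simp add: dihedral_coeff_def gram_def)
next
  case infinity
  then show ?thesis
    using assms by (simp add: dihedral_coeff_def gram_def chebyshev_two)
qed

lemma dihedral_coeff_reflect:
  assumes "s \<noteq> t" "N s t = enat m" "k \<le> m"
  shows "dihedral_coeff s t (m - k) = dihedral_coeff s t k"
proof -
  have "2 \<le> m" using N_ge_2[OF assms(1)] assms by (simp add: numeral_eq_enat)
  then show ?thesis
    using assms chebyshev_reflect[of m k] by (simp add: dihedral_coeff_def gram_def)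
qed

lemma finite_entry_ge_2: "s \<noteq> t \<Longrightarrow> N s t = enat m \<Longrightarrow> 2 \<le> m"
  using N_ge_2[of s t] by (simp add: numeral_eq_enat)

lemma dihedral_coeff_end:
  assumes "s \<noteq> t" "N s t = enat m"
  shows "dihedral_coeff s t m = 0" "dihedral_coeff s t (m - 1) = 1" "dihedral_coeff s t (Suc m) = -1"
proof -
  have m: "2 \<le> m" using finite_entry_ge_2 assms by blast
  show 0: "dihedral_coeff s t m = 0"
    using dihedral_coeff_reflect[of s t m 0] assms by simp
  show 1: "dihedral_coeff s t (m - 1) = 1"
    using dihedral_coeff_reflect[of s t m 1] assms m by simp
  have "dihedral_coeff s t (Suc (Suc (m - 1)))
      = - 2 * gram s t * dihedral_coeff s t (Suc (m - 1)) - dihedral_coeff s t (m - 1)"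
    by (simp add: dihedral_coeff_def)
  then show "dihedral_coeff s t (Suc m) = -1"
    using 0 1 m by simp
qed

text \<open>The indexing starts at \<open>0\<close>: if \<open>N s t = enat m\<close>, the positive roots belong to \<open>k < m\<close>.\<close>

definition dihedral_root :: "'i \<Rightarrow> 'i \<Rightarrow> nat \<Rightarrow> 'i \<Rightarrow> real" where
  "dihedral_root s t k =
    lincomb (dihedral_coeff s t (Suc k)) (basis s) (dihedral_coeff s t k) (basis t)"

lemma fin_supp_dihedral_root [simp]: "fin_supp (dihedral_root s t k)"
  by (simp add: dihedral_root_def)

text \<open>Peeling off the first letter exchanges \<open>s\<close> and \<open>t\<close>, and the
  reflection in \<open>basis s\<close> then performs one step of the Chebyshev recursion.\<close>

lemma act_alternating_next:
  "act (alternating s t k) (basis (if even k then s else t)) = dihedral_root s t k"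
proof (induction k arbitrary: s t)
  case 0
  then show ?case by (simp add: dihedral_root_def)
next
  case (Suc k)
  have "act (alternating s t (Suc k)) (basis (if even (Suc k) then s else t))
    = reflection (basis s) (dihedral_root t s k)"
    by (simp add: act_Cons flip: Suc[of t s])
  also have "\<dots> = dihedral_root s t (Suc k)"
    by (simp add: dihedral_root_def reflection_lincomb)
      (simp add: reflection_def dihedral_coeff_sym[of t s],
        simp add: lincomb_def dihedral_coeff_def algebra_simps)
  finally show ?case .
qed

lemma act_alternating_last:
  "act (alternating s t (Suc k)) (basis (if even k then s else t)) = (\<lambda>q. - dihedral_root s t k q)"
  by (simp add: alternating_Suc_right act_snoc_self act_alternating_next
      del: alternating.simps(2))

lemma dihedral_root_end:
  assumes "s \<noteq> t" "N s t = enat m"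
  shows "dihedral_root s t (m - 1) = basis t" "dihedral_root s t m = (\<lambda>q. - basis s q)"
  using dihedral_coeff_end[OF assms] finite_entry_ge_2[OF assms]
  by (simp_all add: dihedral_root_def lincomb_def)

lemma dihedral_root_reflect:
  assumes "s \<noteq> t" "N s t = enat m" "k < m"
  shows "dihedral_root t s (m - Suc k) = dihedral_root s t k"
  using dihedral_coeff_reflect[of s t m k] dihedral_coeff_reflect[of s t m "Suc k"] assms
  by (simp add: dihedral_root_def Suc_diff_Suc dihedral_coeff_sym[of t s]) (simp add: lincomb_def add.commute)

text \<open>Split \<open>v\<close> into a part orthogonal to both simple roots, which both sides
  fix, and a part in their plane, where only the images of \<open>basis s\<close> and
  \<open>basis t\<close> have to be compared.\<close>

lemma act_braid:
  assumes st: "s \<noteq> t" and m: "N s t = enat m" and v: "fin_supp v"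
  shows "act (alternating s t m) v = act (alternating t s m) v"
proof -
  let ?u = "alternating s t m" and ?w = "alternating t s m"
  have m2: "2 \<le> m" using finite_entry_ge_2[OF st m] .
  then obtain n where n: "m = Suc n" by (cases m) auto
  have m': "N t s = enat m" using m by (simp add: N_sym)
  \<comment> \<open>The last letters of \<open>?u\<close> and \<open>?w\<close>. The last letter of
    one word is the letter that would come next in the other, so each basis vector falls under one
    of the two formulas for alternating words.\<close>
  let ?l = "if even n then s else t" and ?l' = "if even n then t else s"
  have "act ?u (basis ?l) = (\<lambda>q. - basis t q)" "act ?w (basis ?l') = (\<lambda>q. - basis s q)"
    using act_alternating_last[of s t n] act_alternating_last[of t s n]
      dihedral_root_end(1)[OF st m] dihedral_root_end(1)[OF st[symmetric] m'] n by simp_all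
  moreover have "act ?u (basis ?l') = (\<lambda>q. - basis s q)" "act ?w (basis ?l) = (\<lambda>q. - basis t q)"
    using act_alternating_next[of s t m] act_alternating_next[of t s m]
      dihedral_root_end(2)[OF st m] dihedral_root_end(2)[OF st[symmetric] m'] n
    by (auto split: if_splits)
  ultimately have st_eq: "act ?u (basis s) = act ?w (basis s)" "act ?u (basis t) = act ?w (basis t)"
    by (auto split: if_splits)
  \<comment> \<open>The determinant of the Gram matrix of the plane, here sin(pi / m) squared. By
    Cramer's rule \<open>p\<close> is the orthogonal projection of \<open>v\<close> to the
    plane.\<close>
  define D where "D = 1 - gram s t ^ 2"
  have "0 < sin (pi / real m)"
    using sin_pi_div_pos[of m 1] m2 by simp
  then have D: "D \<noteq> 0"
    using m sin_squared_eq[of "pi / real m"] by (auto simp: D_def gram_def)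
  define x where "x = (form (basis s) v - gram s t * form (basis t) v) / D"
  define y where "y = (form (basis t) v - gram s t * form (basis s) v) / D"
  define p where "p = lincomb x (basis s) y (basis t)"
  define z where "z = lincomb 1 v (-1) p"
  have fin: "fin_supp p" "fin_supp z" using v by (simp_all add: p_def z_def)
  have "x + y * gram s t = form (basis s) v" "x * gram s t + y = form (basis t) v"
    using D by (simp_all add: x_def y_def divide_simps) (simp_all add: D_def algebra_simps power2_eq_square)
  then have z: "form (basis s) z = 0" "form (basis t) z = 0"
    using v by (simp_all add: z_def p_def form_lincomb_right gram_sym[of t s])
  have "act d z = z" if "set d \<subseteq> {s, t}" for d
    using that by (induction d) (use z in \<open>auto simp: act_Cons reflection_def\<close>)
  then have "act ?u z = act ?w z"
    by (metis set_alternating insert_commute)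
  moreover have "act ?u p = act ?w p"
    by (simp add: p_def act_lincomb st_eq)
  moreover have "v = lincomb 1 z 1 p"
    by (simp add: z_def lincomb_def)
  ultimately show ?thesis
    using fin by (metis act_lincomb)
qed

lemma form_root [simp]: "form (act w (basis s)) (act w (basis t)) = gram s t"
  by (simp add: form_act)

text \<open>Cosine is injective on [0, pi], and -1 is attained at an infinite entry only. Since
  \<open>act\<close> preserves the form, a pair of roots thus remembers the matrix entry of the
  simple roots it came from.\<close>

lemma gram_inject:
  assumes "s \<noteq> t" "x \<noteq> y" "gram s t = gram x y"
  shows "N s t = N x y"
proof -
  have less: "- 1 < - cos (pi / real k)" if "2 \<le> k" for k
  proof -
    have "cos (pi / real k) < cos 0"
      by (rule cos_monotone_0_pi) (use that in \<open>auto simp: field_simps\<close>)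
    then show ?thesis by simp
  qed
  have inj: "k = l" if "2 \<le> k" "2 \<le> l" "cos (pi / real k) = cos (pi / real l)" for k l
  proof -
    have "pi / real k = pi / real l"
      by (rule cos_inj_pi) (use that in \<open>auto simp: field_simps\<close>)
    then show ?thesis using that by simp
  qed
  show ?thesis
    using assms less inj finite_entry_ge_2[of s t] finite_entry_ge_2[of x y]
    by (fastforce simp: gram_def split: enat.splits)
qed

end

section \<open>Reduced words and positivity of roots\<close>

definition word_prod :: "('g, 'm) monoid_scheme \<Rightarrow> ('i \<Rightarrow> 'g) \<Rightarrow> 'i list \<Rightarrow> 'g" where
  "word_prod G f w = foldr (\<lambda>s g. f s \<otimes>\<^bsub>G\<^esub> g) w \<one>\<^bsub>G\<^esub>"

lemma word_prod_Nil [simp]: "word_prod G f [] = \<one>\<^bsub>G\<^esub>"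
  by (simp add: word_prod_def)

lemma word_prod_Cons [simp]: "word_prod G f (s # w) = f s \<otimes>\<^bsub>G\<^esub> word_prod G f w"
  by (simp add: word_prod_def)

context group
begin

lemma word_prod_closed [simp]:
  "(\<And>x. x \<in> set w \<Longrightarrow> f x \<in> carrier G) \<Longrightarrow> word_prod G f w \<in> carrier G"
  by (induction w) auto

lemma word_prod_append:
  "(\<And>x. x \<in> set u \<union> set v \<Longrightarrow> f x \<in> carrier G) \<Longrightarrow>
    word_prod G f (u @ v) = word_prod G f u \<otimes> word_prod G f v"
  by (induction u) (auto simp: m_assoc)

lemma inv_mult_cancel [simp]:
  assumes "x \<in> carrier G" "y \<in> carrier G"
  shows "inv x \<otimes> (x \<otimes> y) = y" "x \<otimes> (inv x \<otimes> y) = y"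
  using assms by (simp_all flip: m_assoc)

end

section \<open>The Coxeter group as words up to congruence\<close>

context coxeter_matrix
begin

text \<open>Intermediate words must stay over \<open>X\<close>: this is the Coxeter group of
  \<open>X\<close> by its own presentation. That it embeds into the group of a larger set is a
  consequence of \<open>act_faithful\<close>.\<close>

inductive cox_eq :: "'i set \<Rightarrow> 'i list \<Rightarrow> 'i list \<Rightarrow> bool" for X where
  refl: "set w \<subseteq> X \<Longrightarrow> cox_eq X w w"
| square: "x \<in> X \<Longrightarrow> cox_eq X [x, x] []"
| braid: "x \<in> X \<Longrightarrow> y \<in> X \<Longrightarrow> x \<noteq> y \<Longrightarrow> N x y = enat k \<Longrightarrow>
    cox_eq X (alternating x y k) (alternating y x k)"
| sym: "cox_eq X u v \<Longrightarrow> cox_eq X v u"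
| trans [trans]: "cox_eq X u v \<Longrightarrow> cox_eq X v w \<Longrightarrow> cox_eq X u w"
| append: "cox_eq X u u' \<Longrightarrow> cox_eq X v v' \<Longrightarrow> cox_eq X (u @ v) (u' @ v')"

lemma alternating_subset: "s \<in> X \<Longrightarrow> t \<in> X \<Longrightarrow> set (alternating s t k) \<subseteq> X"
  using set_alternating[of s t k] by auto

lemma cox_eq_set: "cox_eq X u v \<Longrightarrow> set u \<subseteq> X \<and> set v \<subseteq> X"
  by (induction rule: cox_eq.induct) (simp_all add: alternating_subset)

lemma cox_eq_act: "cox_eq X u v \<Longrightarrow> fin_supp z \<Longrightarrow> act u z = act v z"
  by (induction arbitrary: z rule: cox_eq.induct) (auto simp: act_append act_double intro: act_braid)

lemma cox_eq_rev: "cox_eq X u v \<Longrightarrow> cox_eq X (rev u) (rev v)"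
proof (induction rule: cox_eq.induct)
  case (braid x y k)
  then show ?case
    using cox_eq.braid[of x X y k] cox_eq.braid[of y X x k] by (auto simp: rev_alternating N_sym)
qed (auto intro: cox_eq.intros simp: cox_eq.refl)

lemma cox_eq_cancel:
  assumes "set u \<subseteq> X" "set v \<subseteq> X" "x \<in> X"
  shows "cox_eq X (u @ [x, x] @ v) (u @ v)"
  using cox_eq.append[OF cox_eq.refl[OF assms(1)]
      cox_eq.append[OF cox_eq.square[OF assms(3)] cox_eq.refl[OF assms(2)]]] by simp

lemma cox_eq_appendR: "set v \<subseteq> X \<Longrightarrow> cox_eq X w w' \<Longrightarrow> cox_eq X (w @ v) (w' @ v)"
  by (intro cox_eq.append cox_eq.refl)

lemma cox_eq_appendL: "set v \<subseteq> X \<Longrightarrow> cox_eq X w w' \<Longrightarrow> cox_eq X (v @ w) (v @ w')"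
  by (intro cox_eq.append cox_eq.refl)

lemma cox_eq_rev_left: "set u \<subseteq> X \<Longrightarrow> cox_eq X (rev u @ u) []"
proof (induction u)
  case (Cons a u)
  then show ?case
    using cox_eq_cancel[of "rev u" X u a] by (auto intro: cox_eq.trans)
qed (simp add: cox_eq.refl)

definition reduced :: "'i set \<Rightarrow> 'i list \<Rightarrow> bool" where
  "reduced X w \<longleftrightarrow> set w \<subseteq> X \<and> (\<forall>u. cox_eq X u w \<longrightarrow> length w \<le> length u)"

text \<open>For reduced \<open>w\<close> this says that multiplication by \<open>x\<close> increases
  the length. The weak inequality is equivalent, since congruent words have lengths of the same
  parity.\<close>

definition ascent :: "'i set \<Rightarrow> 'i list \<Rightarrow> 'i \<Rightarrow> bool" where
  "ascent X w x \<longleftrightarrow> (\<forall>u. cox_eq X u (w @ [x]) \<longrightarrow> length w \<le> length u)"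

lemma obtain_reduced:
  assumes "set w \<subseteq> X"
  obtains r where "reduced X r" "cox_eq X r w"
proof -
  obtain r where r: "cox_eq X r w" "\<And>u. cox_eq X u w \<Longrightarrow> length r \<le> length u"
    using exists_least_iff[of "\<lambda>n. \<exists>u. cox_eq X u w \<and> length u = n"] cox_eq.refl[OF assms]
    by (metis linorder_not_less)
  then have "reduced X r"
    unfolding reduced_def using cox_eq_set cox_eq.trans by blast
  then show ?thesis using that r(1) by blast
qed

lemma reduced_distinct_adj:
  assumes "reduced X (v @ d)"
  shows "distinct_adj d"
proof (rule ccontr)
  assume "\<not> distinct_adj d"
  then obtain a y b where d: "d = a @ [y, y] @ b"
  proof (induction d arbitrary: thesis)
    case (Cons x d)
    show ?case
    proof (cases "distinct_adj d")
      case True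
      then obtain d' where "d = x # d'"
        using Cons.prems(2) by (cases d) (auto simp: distinct_adj_Cons)
      then show ?thesis using Cons.prems(1)[of "[]" x d'] by simp
    next
      case False
      then obtain a y b where "d = a @ [y, y] @ b" using Cons.IH by blast
      then show ?thesis using Cons.prems(1)[of "x # a" y b] by simp
    qed
  qed simp
  have "cox_eq X (v @ a @ b) (v @ d)"
    using cox_eq_cancel[of "v @ a" X b y] assms unfolding reduced_def d
    by (auto intro: cox_eq.sym)
  then show False
    using assms unfolding reduced_def d by fastforce
qed

text \<open>
  The suffix of \<open>w\<close> in the letters \<open>s\<close>, \<open>t\<close> is taken as long as possible. It cannot end in \<open>s\<close>, because
  \<open>s\<close> is an ascent; so it alternates, and it is too short to be rewritten by a braid relation.
\<close>

lemma dihedral_decomposition: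
  assumes w: "reduced X w" and asc: "ascent X w s" and X: "s \<in> X" "t \<in> X" and st: "s \<noteq> t"
  obtains v k where "cox_eq X (v @ rev (alternating t s k)) w" "length v + k = length w"
    "reduced X v" "ascent X v s" "ascent X v t" "enat k < N s t"
    "\<And>w'. w = w' @ [t] \<Longrightarrow> 0 < k"
proof -
  define P where "P v d \<longleftrightarrow> cox_eq X (v @ d) w \<and> length v + length d = length w \<and> set d \<subseteq> {s, t}"
    for v d
  have "P w []"
    using w by (simp add: P_def reduced_def cox_eq.refl)
  then have "\<exists>v d. P v d \<and> (\<forall>v' d'. P v' d' \<longrightarrow> length v \<le> length v')"
    using exists_least_iff[of "\<lambda>n. \<exists>v d. P v d \<and> length v = n"] by (metis linorder_not_less)
  then obtain v d where P: "P v d" and min: "\<And>v' d'. P v' d' \<Longrightarrow> length v \<le> length v'"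
    by blast
  from P have vd: "cox_eq X (v @ d) w" and len: "length v + length d = length w"
    and d: "set d \<subseteq> {s, t}" by (auto simp: P_def)
  have sets: "set v \<subseteq> X" "set d \<subseteq> X" "set w \<subseteq> X"
    using cox_eq_set[OF vd] by auto
  have short: "length w \<le> length u" if "cox_eq X u w" for u
    using w that by (simp add: reduced_def)
  have red_vd: "reduced X (v @ d)"
    unfolding reduced_def using sets short len vd cox_eq.trans by fastforce
  have red_v: "reduced X v"
    unfolding reduced_def
  proof (intro conjI allI impI sets)
    fix u assume "cox_eq X u v"
    then have "cox_eq X (u @ d) w"
      using vd cox_eq_appendR[OF sets(2)] cox_eq.trans by blast
    then show "length v \<le> length u" using short len by fastforce
  qed
  \<comment> \<open>A word \<open>u\<close> for \<open>v @ [y]\<close> that is shorter than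
    \<open>v\<close> could be followed by the suffix \<open>y # d\<close>, against the minimality of
    \<open>v\<close>.\<close>
  have asc_v: "ascent X v y" if y: "y \<in> {s, t}" for y
    unfolding ascent_def
  proof (intro allI impI, rule ccontr)
    fix u assume u: "cox_eq X u (v @ [y])" "\<not> length v \<le> length u"
    have yX: "y \<in> X" using y X by auto
    have "cox_eq X (u @ (y # d)) (v @ [y, y] @ d)"
      using cox_eq_appendR[OF _ u(1), of "y # d"] yX sets by simp
    also have "cox_eq X \<dots> (v @ d)" using cox_eq_cancel sets yX by blast
    also note vd
    finally have *: "cox_eq X (u @ (y # d)) w" .
    then have "P u (y # d)"
      using short[OF *] u(2) len y d by (auto simp: P_def)
    then show False using min u(2) by blast
  qed
  \<comment> \<open>Otherwise \<open>s\<close> would cancel in \<open>w @ [s]\<close>, leaving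
    \<open>v @ e\<close>, which is shorter than \<open>w\<close>.\<close>
  have no_s: "\<not> cox_eq X (e @ [s]) d" if e: "length e < length d" for e
  proof
    assume es: "cox_eq X (e @ [s]) d"
    then have e_set: "set e \<subseteq> X" using cox_eq_set by fastforce
    have "cox_eq X (v @ e @ [s]) w"
      using es vd cox_eq_appendL[OF sets(1) es] cox_eq.trans by blast
    then have "cox_eq X ((v @ e) @ [s, s] @ []) (w @ [s])"
      using cox_eq_appendR[of "[s]" X "v @ e @ [s]" w] X by simp
    then have "cox_eq X (v @ e) (w @ [s])"
      using cox_eq_cancel[of "v @ e" X "[]" s] sets e_set X
      by (metis append_Nil2 cox_eq.sym cox_eq.trans empty_subsetI le_sup_iff list.set(1) set_append)
    then have "length w \<le> length (v @ e)" using asc unfolding ascent_def by blast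
    then show False using e len by simp
  qed
  have "hd (rev d) = t" if ne: "rev d \<noteq> []"
  proof (rule ccontr)
    assume "hd (rev d) \<noteq> t"
    moreover have "last d \<in> {s, t}" using ne d last_in_set[of d] by (metis rev_is_Nil_conv subsetD)
    ultimately have "last d = s" by (auto simp: hd_rev)
    then have "d = butlast d @ [s]"
      using ne append_butlast_last_id[of d] by simp
    moreover have "length (butlast d) < length d" using ne by (cases d) auto
    ultimately show False using no_s cox_eq.refl[OF sets(2)] by metis
  qed
  then have "rev d = alternating t s (length d)"
    using distinct_adj_alternating[of "rev d" t s] d reduced_distinct_adj[OF red_vd] by auto
  then have d_alt: "d = rev (alternating t s (length d))" by (metis rev_rev_ident)
  define k where "k = length d"
  have d_eq: "d = rev (alternating t s k)" using d_alt by (simp add: k_def)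
  have less: "enat k < N s t"
  proof (rule ccontr)
    assume "\<not> enat k < N s t"
    then obtain m where m: "N s t = enat m" "m \<le> k" by (cases "N s t") auto
    have m2: "2 \<le> m" using finite_entry_ge_2[OF st m(1)] .
    \<comment> \<open>What precedes the last \<open>m\<close> letters of \<open>d\<close>. The braid
      relation turns those letters into a word that ends in \<open>s\<close>.\<close>
    define c where "c = rev (if even m then alternating t s (k - m) else alternating s t (k - m))"
    have d_c: "d = c @ rev (alternating t s m)"
      using alternating_append[of t s m "k - m"] m by (simp add: d_eq c_def)
    have "cox_eq X (alternating s t m) (alternating t s m)"
      by (rule cox_eq.braid) (use X st m in auto)
    then have *: "cox_eq X (c @ rev (alternating s t m)) d"
      unfolding d_c using cox_eq_appendL[of c X] cox_eq_rev sets d_c by auto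
    have "rev (alternating s t m) = rev (alternating t s (m - 1)) @ [s]"
      using m2 by (cases m) auto
    then have "cox_eq X ((c @ rev (alternating t s (m - 1))) @ [s]) d"
      using * by simp
    moreover have "length (c @ rev (alternating t s (m - 1))) < length d"
      using m2 by (simp add: d_c)
    ultimately show False using no_s by blast
  qed
  have k_pos: "0 < k" if "w = w' @ [t]" for w'
  proof -
    have "P w' [t]" using that sets by (simp add: P_def cox_eq.refl)
    then show ?thesis using min[of w' "[t]"] that len by (auto simp: k_def)
  qed
  show thesis
  proof (rule that)
    show "cox_eq X (v @ rev (alternating t s k)) w" using vd by (simp flip: d_eq)
    show "length v + k = length w" using len by (simp add: k_def)
    show "reduced X v" by (rule red_v)
    show "ascent X v s" "ascent X v t" by (simp_all add: asc_v)
    show "enat k < N s t" by (rule less)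
    show "\<And>w'. w = w' @ [t] \<Longrightarrow> 0 < k" by (rule k_pos)
  qed
qed

lemma act_rev_alternating:
  "act (rev (alternating t s k)) (basis s) =
    (if even k then dihedral_root s t k else dihedral_root t s k)"
  using act_alternating_next[of s t k] act_alternating_next[of t s k]
  by (auto simp: rev_alternating)

lemma dihedral_coeff_nonneg: "s \<noteq> t \<Longrightarrow> enat k \<le> N s t \<Longrightarrow> 0 \<le> dihedral_coeff s t k"
  using dihedral_coeff_pos[of s t k] dihedral_coeff_end(1)[of s t k]
  by (cases k) (auto simp: le_less)

text \<open>Humphreys, Reflection Groups and Coxeter Groups, Theorem 5.4.\<close>

theorem nonneg_ascent:
  assumes "reduced X w" "ascent X w x" "x \<in> X"
  shows "nonneg (act w (basis x))"
  using assms
proof (induction w arbitrary: x rule: measure_induct_rule[of length])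
  case (less w)
  show ?case
  proof (cases w rule: rev_cases)
    case Nil
    then show ?thesis by simp
  next
    case (snoc w' t)
    have t: "t \<in> X" "set w' \<subseteq> X" using less.prems snoc by (auto simp: reduced_def)
    have "x \<noteq> t"
    proof
      assume "x = t"
      then have "cox_eq X w' (w @ [x])"
        using cox_eq_cancel[of w' X "[]" t] t snoc by (simp add: cox_eq.sym)
      then show False using less.prems snoc unfolding ascent_def by fastforce
    qed
    then obtain v k where vk: "cox_eq X (v @ rev (alternating t x k)) w" "length v + k = length w"
      "reduced X v" "ascent X v x" "ascent X v t" "enat k < N x t" "0 < k"
      using dihedral_decomposition[OF less.prems(1,2,3) t(1)] snoc by metis
    have IH: "nonneg (act v (basis x))" "nonneg (act v (basis t))"
      using less.IH[of v] vk less.prems t by auto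
    have coeff: "0 \<le> dihedral_coeff x t k" "0 \<le> dihedral_coeff x t (Suc k)"
      using dihedral_coeff_nonneg[of x t] vk(6) \<open>x \<noteq> t\<close> by (auto simp: Suc_ile_eq)
    \<comment> \<open>The dihedral suffix yields a combination of the simple roots of
      \<open>x\<close> and \<open>t\<close> with nonnegative coefficients, and \<open>v\<close> is
      shorter than \<open>w\<close> because \<open>0 < k\<close>.\<close>
    have "act w (basis x) = act v (act (rev (alternating t x k)) (basis x))"
      using cox_eq_act[OF vk(1), of "basis x"] by (simp add: act_append)
    then show ?thesis
      using IH coeff
      by (simp add: act_rev_alternating dihedral_root_def act_lincomb nonneg_lincomb
          dihedral_coeff_sym[of t x])
  qed
qed

text \<open>Let \<open>z\<close> be a reduced word for \<open>w @ [x]\<close>. It is shorter than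
  \<open>w\<close>, so \<open>x\<close> is an ascent of \<open>z\<close>, and passing from
  \<open>z\<close> to \<open>w\<close> changes the sign of the root.\<close>

lemma nonpos_not_ascent:
  assumes w: "reduced X w" and x: "x \<in> X" and "\<not> ascent X w x"
  shows "nonneg (\<lambda>q. - act w (basis x) q)"
proof -
  obtain u where u: "cox_eq X u (w @ [x])" "length u < length w"
    using assms by (auto simp: ascent_def not_le)
  have "set (w @ [x]) \<subseteq> X" using cox_eq_set[OF u(1)] by simp
  then obtain z where z: "reduced X z" "cox_eq X z (w @ [x])"
    by (rule obtain_reduced)
  have len: "length z < length w" using z u unfolding reduced_def
    by (metis cox_eq.sym cox_eq.trans order.strict_trans1)
  have zX: "set w \<subseteq> X" "set z \<subseteq> X" using w z by (auto simp: reduced_def)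
  have "cox_eq X (z @ [x]) (w @ [x, x] @ [])"
    using cox_eq_appendR[OF _ z(2), of "[x]"] x by simp
  also have "cox_eq X \<dots> w"
    using cox_eq_cancel[of w X "[]" x] zX x by simp
  finally have zx: "cox_eq X (z @ [x]) w" .
  have "ascent X z x"
    unfolding ascent_def
    using w zx len cox_eq.trans unfolding reduced_def by fastforce
  then have "nonneg (act z (basis x))" using nonneg_ascent z x by blast
  moreover have "act w (basis x) = (\<lambda>q. - act z (basis x) q)"
    using cox_eq_act[OF zx, of "basis x"] by (simp add: act_snoc_self)
  ultimately show ?thesis by simp
qed

lemma not_nonneg_uminus_basis: "\<not> nonneg (\<lambda>q. - basis s q)"
  by (auto simp: nonneg_def basis_def intro!: exI[of _ s])

lemma ascent_if_simple:
  assumes "reduced X w" "x \<in> X" "act w (basis x) = basis y"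
  shows "ascent X w x"
  using nonpos_not_ascent[OF assms(1,2)] assms(3) not_nonneg_uminus_basis by metis

lemma root_sign: "nonneg (act w (basis s)) \<or> nonneg (\<lambda>q. - act w (basis s) q)"
proof -
  obtain r where r: "reduced UNIV r" "cox_eq UNIV r w"
    using obtain_reduced[of w UNIV] by blast
  have "act w (basis s) = act r (basis s)"
    using cox_eq_act[OF r(2)] by simp
  then show ?thesis
    using nonneg_ascent[OF r(1)] nonpos_not_ascent[OF r(1)] by auto
qed

text \<open>A reduced word for the quotient of \<open>u\<close> and \<open>v\<close> fixes the
  simple roots of \<open>X\<close>, so every letter of \<open>X\<close> is an ascent of it. But the
  last letter of a nonempty reduced word is not an ascent.\<close>

theorem act_faithful:
  assumes u: "set u \<subseteq> X" and v: "set v \<subseteq> X"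
    and eq: "\<And>x. x \<in> X \<Longrightarrow> act u (basis x) = act v (basis x)"
  shows "cox_eq X u v"
proof -
  obtain r where r: "reduced X r" "cox_eq X r (rev v @ u)"
    using obtain_reduced[of "rev v @ u" X] u v by auto
  have id: "act r (basis x) = basis x" if "x \<in> X" for x
    using cox_eq_act[OF r(2), of "basis x"] eq[OF that] by (simp add: act_append act_rev)
  have "r = []"
  proof (cases r rule: rev_cases)
    case (snoc r' x)
    have X: "x \<in> X" "set r' \<subseteq> X" using r snoc by (auto simp: reduced_def)
    have "cox_eq X r' (r @ [x])"
      using cox_eq_cancel[of r' X "[]" x] X snoc by (simp add: cox_eq.sym)
    then have "\<not> ascent X r x" using snoc by (auto simp: ascent_def)
    then show ?thesis
      using ascent_if_simple[OF r(1) X(1) id[OF X(1)]] by simp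
  qed simp
  then have *: "cox_eq X [] (rev v @ u)" using r by simp
  have "cox_eq X u (rev (rev v) @ rev v @ u)"
    using cox_eq_appendR[OF u cox_eq.sym[OF cox_eq_rev_left[of "rev v" X]]] v by simp
  also have "cox_eq X \<dots> (v @ [])"
    using cox_eq_appendL[OF v cox_eq.sym[OF *]] by simp
  finally show ?thesis by simp
qed

section \<open>Roots supported on a subset\<close>

lemma supported_act:
  assumes "set u \<subseteq> X" "supported X v"
  shows "supported X (act u v)"
  using assms
  by (induction u) (auto simp: act_Cons reflection_def intro!: supported_lincomb)

lemma root_on_axis:
  assumes "nonneg (act w (basis x))" "\<And>q. q \<noteq> s \<Longrightarrow> act w (basis x) q = 0"
  shows "act w (basis x) = basis s"
proof -
  define c where "c = act w (basis x) s"
  have c: "act w (basis x) = lincomb c (basis s) 0 (basis s)"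
    using assms(2) by (auto simp: lincomb_def basis_def c_def)
  have "form (act w (basis x)) (act w (basis x)) = 1"
    by simp
  then have "c * c = 1"
    unfolding c by (simp add: form_lincomb_left form_lincomb_right)
  moreover have "0 \<le> c" using assms(1) by (simp add: c_def nonneg_def)
  ultimately have "c = 1" using square_eq_1_iff[of c] by auto
  then show ?thesis
    unfolding c by (simp add: lincomb_def)
qed

text \<open>Expand \<open>basis s\<close> in the vectors \<open>act (rev w) (basis x)\<close>, the
  coefficients being the coordinates of its image. By \<open>root_sign\<close> these are
  nonnegative. A sum of nonnegative vectors lies on the axis of \<open>s\<close> only if each
  summand does, and a nonnegative root on that axis is \<open>basis s\<close>.\<close>

lemma simple_if_supported:
  assumes pos: "\<And>x. x \<in> J \<Longrightarrow> nonneg (act (rev w) (basis x))"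
    and supp: "supported J (act w (basis s))"
  obtains x where "x \<in> J" "act w (basis s) = basis x"
proof -
  let ?b = "act w (basis s)"
  let ?A = "{t. ?b t \<noteq> 0}"
  have fin: "finite ?A" using fin_supp_act[of "basis s" w] by (simp add: fin_supp_def)
  have AJ: "?A \<subseteq> J" using supp by (auto simp: supported_def)
  have expand: "basis s q = (\<Sum>t\<in>?A. ?b t * act (rev w) (basis t) q)" for q
    using act_expand[OF fin order_refl, of "rev w" q] by (simp add: act_rev)
  have b: "nonneg ?b"
  proof (rule ccontr)
    assume "\<not> nonneg ?b"
    then have "\<And>t. ?b t \<le> 0" using root_sign[of w s] by (auto simp: nonneg_def)
    then have "basis s s \<le> 0"
      unfolding expand[of s] using pos AJ
      by (intro sum_nonpos mult_nonpos_nonneg) (auto simp: nonneg_def)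
    then show False by (simp add: basis_def)
  qed
  have "?A \<noteq> {}"
  proof
    assume *: "?A = {}"
    show False using expand[of s] unfolding * by (simp add: basis_def)
  qed
  then obtain x where x: "?b x \<noteq> 0" "x \<in> J" using AJ by blast
  have bx: "0 < ?b x" using b x by (simp add: nonneg_def less_le)
  have zero: "act (rev w) (basis x) q = 0" if "q \<noteq> s" for q
  proof -
    have "?b x * act (rev w) (basis x) q \<le> (\<Sum>t\<in>?A. ?b t * act (rev w) (basis t) q)"
      by (rule member_le_sum) (use x fin AJ b pos in \<open>auto simp: nonneg_def\<close>)
    also have "\<dots> = 0" using expand[of q] that by (simp add: basis_def)
    finally show ?thesis
      using bx pos[OF x(2)] by (simp add: nonneg_def mult_le_0_iff) (metis less_le_not_le order.antisym)
  qed
  have "act (rev w) (basis x) = basis s"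
    by (rule root_on_axis[OF pos[OF x(2)] zero])
  then have "?b = basis x"
    using act_rev'[of "basis x" w] by simp
  then show thesis using that x by blast
qed

text \<open>Write the element as \<open>u @ w'\<close> with \<open>u\<close> over \<open>X\<close>
  and \<open>w'\<close> as short as possible. Then \<open>w'\<close> is minimal in its coset, so
  \<open>simple_if_supported\<close> applies to it, with the same \<open>u\<close> for both
  roots.\<close>

lemma parabolic_roots:
  assumes "supported X (act w (basis s))" "supported X (act w (basis t))"
  obtains u x y where "set u \<subseteq> X" "x \<in> X" "y \<in> X"
    "act w (basis s) = act u (basis x)" "act w (basis t) = act u (basis y)"
proof -
  define P where "P u w' \<longleftrightarrow> set u \<subseteq> X \<and> cox_eq UNIV (u @ w') w" for u w'
  have "P [] w" by (simp add: P_def cox_eq.refl)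
  then have "\<exists>u w'. P u w' \<and> (\<forall>u' w''. P u' w'' \<longrightarrow> length w' \<le> length w'')"
    using exists_least_iff[of "\<lambda>n. \<exists>u w'. P u w' \<and> length w' = n"] by (metis linorder_not_less)
  then obtain u w' where P: "P u w'" and min: "\<And>u' w''. P u' w'' \<Longrightarrow> length w' \<le> length w''"
    by blast
  from P have u: "set u \<subseteq> X" and uw: "cox_eq UNIV (u @ w') w" by (auto simp: P_def)
  have red: "reduced UNIV (rev w')"
    unfolding reduced_def
  proof (intro conjI allI impI)
    fix z assume "cox_eq UNIV z (rev w')"
    then have "cox_eq UNIV (u @ rev z) (u @ w')"
      using cox_eq_rev[of UNIV z "rev w'"] cox_eq_appendL[of u UNIV] by simp
    then have "P u (rev z)" using u uw cox_eq.trans by (auto simp: P_def)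
    then show "length (rev w') \<le> length z" using min by fastforce
  qed simp
  have pos: "nonneg (act (rev w') (basis x))" if x: "x \<in> X" for x
  proof (rule nonneg_ascent[OF red])
    show "ascent UNIV (rev w') x"
      unfolding ascent_def
    proof (intro allI impI)
      fix z assume "cox_eq UNIV z (rev w' @ [x])"
      then have "cox_eq UNIV ((u @ [x]) @ rev z) (u @ [x, x] @ w')"
        using cox_eq_rev[of UNIV z "rev w' @ [x]"] cox_eq_appendL[of "u @ [x]" UNIV] by simp
      also have "cox_eq UNIV \<dots> (u @ w')" by (rule cox_eq_cancel) auto
      also note uw
      finally have "P (u @ [x]) (rev z)" using u x by (simp add: P_def)
      then show "length (rev w') \<le> length z" using min by fastforce
    qed
  qed simp
  have eq: "act w (basis q) = act u (act w' (basis q))" for q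
    using cox_eq_act[OF uw, of "basis q"] by (simp add: act_append)
  have "supported X (act w' (basis q))" if "supported X (act w (basis q))" for q
    using supported_act[of "rev u" X "act w (basis q)"] that u by (simp add: eq act_rev)
  then obtain x y where "x \<in> X" "act w' (basis s) = basis x" "y \<in> X" "act w' (basis t) = basis y"
    using simple_if_supported[OF pos] assms by metis
  then show thesis using that[of u x y] u by (simp add: eq)
qed

end

section \<open>Groups with the virtual Artin relations over \<open>X\<close>\<close>

locale virtual_artin_system = coxeter_matrix N + group G
  for N :: "'i \<Rightarrow> 'i \<Rightarrow> enat" and G (structure) +
  fixes X :: "'i set" and \<sigma> \<tau> :: "'i \<Rightarrow> 'a"
  assumes \<sigma>_closed [simp]: "x \<in> X \<Longrightarrow> \<sigma> x \<in> carrier G"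
    and \<tau>_closed [simp]: "x \<in> X \<Longrightarrow> \<tau> x \<in> carrier G"
    and \<sigma>_braid: "x \<in> X \<Longrightarrow> y \<in> X \<Longrightarrow> x \<noteq> y \<Longrightarrow> N x y = enat k \<Longrightarrow>
      word_prod G \<sigma> (alternating x y k) = word_prod G \<sigma> (alternating y x k)"
    and \<tau>_square: "x \<in> X \<Longrightarrow> \<tau> x \<otimes> \<tau> x = \<one>"
    and \<tau>_braid: "x \<in> X \<Longrightarrow> y \<in> X \<Longrightarrow> x \<noteq> y \<Longrightarrow> N x y = enat k \<Longrightarrow>
      word_prod G \<tau> (alternating x y k) = word_prod G \<tau> (alternating y x k)"
    and mixed: "x \<in> X \<Longrightarrow> y \<in> X \<Longrightarrow> x \<noteq> y \<Longrightarrow> N x y = enat k \<Longrightarrow>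
      \<sigma> x \<otimes> word_prod G \<tau> (alternating y x (k - 1)) =
      word_prod G \<tau> (alternating y x (k - 1)) \<otimes> \<sigma> (if even k then x else y)"
begin

abbreviation T :: "'i list \<Rightarrow> 'a" where "T \<equiv> word_prod G \<tau>"

lemma T_closed [simp]: "set u \<subseteq> X \<Longrightarrow> T u \<in> carrier G"
  by (rule word_prod_closed) auto

lemma T_append: "set u \<subseteq> X \<Longrightarrow> set v \<subseteq> X \<Longrightarrow> T (u @ v) = T u \<otimes> T v"
  by (rule word_prod_append) auto

lemma T_cong: "cox_eq X u v \<Longrightarrow> T u = T v"
proof (induction rule: cox_eq.induct)
  case (append u u' v v')
  then show ?case using cox_eq_set[of X u u'] cox_eq_set[of X v v'] by (simp add: T_append)
qed (auto simp: \<tau>_square intro: \<tau>_braid)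

text \<open>Take a reduced word and split off a dihedral suffix in \<open>x\<close> and the last
  letter. Then \<open>basis y\<close> is a combination of two nonnegative vectors, which forces one
  coefficient to vanish. Hence the suffix has length m - 1, as in relation v3, and induction applies
  to the rest.\<close>

theorem T_conj:
  assumes "set u \<subseteq> X" "x \<in> X" "y \<in> X" "act u (basis x) = basis y"
  shows "T u \<otimes> \<sigma> x = \<sigma> y \<otimes> T u"
  using assms
proof (induction "length u" arbitrary: u x rule: less_induct)
  case less
  show ?case
  proof -
    obtain r where r: "reduced X r" "cox_eq X r u"
      using obtain_reduced less.prems(1) by blast
    have Tr: "T r = T u" and ar: "act r (basis x) = basis y"
      using T_cong[OF r(2)] cox_eq_act[OF r(2), of "basis x"] less.prems by simp_all
    have len_r: "length r \<le> length u"
      using r cox_eq.sym[OF r(2)] by (auto simp: reduced_def)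
    have "T r \<otimes> \<sigma> x = \<sigma> y \<otimes> T r"
    proof (cases r rule: rev_cases)
      case Nil
      then have "x = y" using ar by simp
      then show ?thesis using Nil less.prems by simp
    next
      case (snoc r' t)
      have rX: "set r' \<subseteq> X" "t \<in> X" using r snoc by (auto simp: reduced_def)
      have asc: "ascent X r x" by (rule ascent_if_simple[OF r(1) less.prems(2) ar])
      have "x \<noteq> t"
      proof
        assume "x = t"
        then have "cox_eq X r' (r @ [x])"
          using cox_eq_cancel[of r' X "[]" t] rX snoc by (simp add: cox_eq.sym)
        then show False using asc snoc unfolding ascent_def by fastforce
      qed
      then obtain v k where vk: "cox_eq X (v @ rev (alternating t x k)) r" "length v + k = length r"
        "reduced X v" "ascent X v x" "ascent X v t" "enat k < N x t" "0 < k"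
        using dihedral_decomposition[OF r(1) asc less.prems(2) rX(2)] snoc by metis
      \<comment> \<open>Chosen by parity so that the suffix reads \<open>alternating a b k\<close>.
        The induction hypothesis will be used for \<open>b\<close>.\<close>
      define a b where "a = (if even k then x else t)" and "b = (if even k then t else x)"
      have ab: "a \<in> X" "b \<in> X" "a \<noteq> b" "N a b = N x t"
        using less.prems rX \<open>x \<noteq> t\<close> by (auto simp: a_def b_def N_sym)
      let ?p = "dihedral_coeff a b"
      have vX: "set v \<subseteq> X" using vk by (simp add: reduced_def)
      have nn: "nonneg (act v (basis a))" "nonneg (act v (basis b))"
        using nonneg_ascent[OF vk(3)] vk(4,5) less.prems rX by (auto simp: a_def b_def)
      have root: "act (rev (alternating t x k)) (basis x) = dihedral_root a b k"
        by (simp add: act_rev_alternating a_def b_def)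
      have "basis y = act v (dihedral_root a b k)"
        using cox_eq_act[OF vk(1), of "basis x"] ar root by (simp add: act_append)
      then have y: "basis y = lincomb (?p (Suc k)) (act v (basis a)) (?p k) (act v (basis b))"
        by (simp add: dihedral_root_def act_lincomb)
      have pk: "0 < ?p k" using dihedral_coeff_pos ab vk by simp
      have "?p (Suc k) = 0"
      proof (rule ccontr)
        assume "?p (Suc k) \<noteq> 0"
        moreover have "0 \<le> ?p (Suc k)"
          by (rule dihedral_coeff_nonneg) (use ab vk in \<open>auto simp: Suc_ile_eq\<close>)
        ultimately have pk': "0 < ?p (Suc k)" by linarith
        have zero: "act v (basis a) q = 0 \<and> act v (basis b) q = 0" if "q \<noteq> y" for q
        proof -
          have "?p (Suc k) * act v (basis a) q + ?p k * act v (basis b) q = 0"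
            using fun_cong[OF y, of q] that by (simp add: basis_def lincomb_def)
          then show ?thesis
            using pk pk' nn by (simp add: nonneg_def add_nonneg_eq_0_iff)
        qed
        \<comment> \<open>Both roots lie on the axis of \<open>y\<close>, with coordinates
          \<open>c\<close> and \<open>d\<close>, so they are proportional. This contradicts the
          injectivity of \<open>act v\<close>.\<close>
        define c d where "c = act v (basis a) y" and "d = act v (basis b) y"
        have "act v (lincomb d (basis a) (- c) (basis b)) = act v (lincomb 0 (basis a) 0 (basis b))"
        proof
          fix q
          show "act v (lincomb d (basis a) (- c) (basis b)) q = act v (lincomb 0 (basis a) 0 (basis b)) q"
            using zero[of q] by (cases "q = y") (auto simp: act_lincomb, auto simp: lincomb_def c_def d_def)
        qed
        then have "lincomb d (basis a) (- c) (basis b) = lincomb 0 (basis a) 0 (basis b)"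
          by (rule act_inj[rotated 2]) simp_all
        from fun_cong[OF this, of a] fun_cong[OF this, of b] have "d = 0" "c = 0"
          using ab by (auto simp: lincomb_def basis_def)
        then show False
          using fun_cong[OF y, of y] by (simp add: basis_def lincomb_def c_def d_def)
      qed
      then have m: "N a b = enat (Suc k)"
        using dihedral_coeff_pos[of a b "Suc k"] ab vk(6) by (metis Suc_ile_eq order_le_less less_irrefl zero_less_Suc)
      have "?p k = 1" using dihedral_coeff_end(2)[OF ab(3) m] by simp
      then have vb: "act v (basis b) = basis y"
        using y \<open>?p (Suc k) = 0\<close> by simp
      have "length v < length u" using vk len_r by simp
      then have IH: "T v \<otimes> \<sigma> b = \<sigma> y \<otimes> T v"
        using less.hyps[of v b] vX ab less.prems vb by blast
      let ?d = "rev (alternating t x k)"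
      have d_alt: "?d = alternating a b k"
        by (simp add: rev_alternating a_def b_def)
      have dX: "set ?d \<subseteq> X" unfolding d_alt by (rule alternating_subset) (use ab in auto)
      \<comment> \<open>Relation v3 for the pair \<open>b\<close>, \<open>a\<close> with entry
        \<open>Suc k\<close>. The letter on its right is \<open>x\<close> for either parity of
        \<open>k\<close>.\<close>
      have "\<sigma> b \<otimes> T (alternating a b (Suc k - 1)) =
        T (alternating a b (Suc k - 1)) \<otimes> \<sigma> (if even (Suc k) then b else a)"
        by (rule mixed) (use ab m in \<open>auto simp: N_sym\<close>)
      then have md: "\<sigma> b \<otimes> T ?d = T ?d \<otimes> \<sigma> x"
        unfolding d_alt by (simp add: a_def b_def split: if_splits)
      have "T r = T v \<otimes> T ?d"
        using T_cong[OF vk(1)] T_append[OF vX dX] by simp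
      then have "T r \<otimes> \<sigma> x = T v \<otimes> (\<sigma> b \<otimes> T ?d)"
        using md vX dX less.prems by (simp add: m_assoc)
      also have "\<dots> = \<sigma> y \<otimes> T v \<otimes> T ?d"
        using IH vX dX ab less.prems by (simp flip: m_assoc)
      finally show ?thesis
        using \<open>T r = T v \<otimes> T ?d\<close> vX dX less.prems by (simp add: m_assoc)
    qed
    then show ?thesis using Tr by simp
  qed
qed

end

section \<open>Artin groups acting on labelled cosets\<close>

lemma take_alternating: "i \<le> m \<Longrightarrow> take i (alternating s t m) = alternating s t i"
  using alternating_append[of s t i "m - i"] by simp

lemma nth_alternating: "i < m \<Longrightarrow> alternating s t m ! i = (if even i then s else t)"
proof (induction i arbitrary: s t m)
  case 0
  then show ?case by (cases m) auto
next
  case (Suc i)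
  then show ?case by (cases m) auto
qed

section \<open>Coxeter group elements as families of roots\<close>

context coxeter_matrix
begin

text \<open>Stored in place of a word, so that congruent words give equal states.\<close>

definition family :: "'i list \<Rightarrow> 'i \<Rightarrow> 'i \<Rightarrow> real" where
  "family w = (\<lambda>s. act w (basis s))"

definition column_op :: "'i \<Rightarrow> ('i \<Rightarrow> 'i \<Rightarrow> real) \<Rightarrow> 'i \<Rightarrow> 'i \<Rightarrow> real" where
  "column_op s c = (\<lambda>t. lincomb 1 (c t) (- 2 * gram s t) (c s))"

lemma family_snoc: "family (w @ [s]) = column_op s (family w)"
  by (simp add: family_def column_op_def act_snoc_basis)

end

section \<open>Steps on minimal coset representatives\<close>

locale emission = coxeter_matrix N + group G
  for N :: "'i \<Rightarrow> 'i \<Rightarrow> enat" and G (structure) +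
  fixes J :: "'i set" and g :: "'i \<Rightarrow> 'a"
  assumes g_closed [simp]: "x \<in> J \<Longrightarrow> g x \<in> carrier G"
    and g_braid: "x \<in> J \<Longrightarrow> y \<in> J \<Longrightarrow> x \<noteq> y \<Longrightarrow> N x y = enat k \<Longrightarrow>
      word_prod G g (alternating x y k) = word_prod G g (alternating y x k)"
begin

text \<open>The root criterion for \<open>w\<close> to be the shortest element of its coset
  \<open>W\<^sub>J w\<close>.\<close>

definition minimal :: "'i list \<Rightarrow> bool" where
  "minimal w \<longleftrightarrow> (\<forall>x\<in>J. nonneg (act (rev w) (basis x)))"

definition label :: "('i \<Rightarrow> real) \<Rightarrow> 'i" where
  "label v = (SOME x. v = basis x)"

text \<open>If \<open>c\<close> sends the simple root of \<open>s\<close> to that of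
  \<open>x\<close> in \<open>J\<close>, then c s = x c lies in the coset of \<open>c\<close>, and
  \<open>x\<close> is the discrepancy. Otherwise c s is the minimal representative of the new coset,
  by \<open>minimal_snoc\<close>.\<close>

fun step :: "'i \<Rightarrow> 'a \<times> ('i \<Rightarrow> 'i \<Rightarrow> real) \<Rightarrow> 'a \<times> ('i \<Rightarrow> 'i \<Rightarrow> real)" where
  "step s (a, c) = (if c s \<in> basis ` J then (a \<otimes> g (label (c s)), c) else (a, column_op s c))"

text \<open>On cosets \<open>s\<close> acts as an involution, so only the emitted letter is
  inverted.\<close>

fun unstep :: "'i \<Rightarrow> 'a \<times> ('i \<Rightarrow> 'i \<Rightarrow> real) \<Rightarrow> 'a \<times> ('i \<Rightarrow> 'i \<Rightarrow> real)" where
  "unstep s (a, c) = (if c s \<in> basis ` J then (a \<otimes> inv g (label (c s)), c) else (a, column_op s c))"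

definition states :: "('a \<times> ('i \<Rightarrow> 'i \<Rightarrow> real)) set" where
  "states = carrier G \<times> family ` {w. minimal w}"

lemma label_basis [simp]: "label (basis x) = x"
  by (simp add: label_def)

text \<open>This makes a hit a linear condition, which can be tested on combinations of
  roots.\<close>

lemma minimal_hit:
  "minimal w \<Longrightarrow> family w s \<in> basis ` J \<longleftrightarrow> supported J (act w (basis s))"
  using simple_if_supported[of J w s] by (auto simp: minimal_def family_def)

text \<open>The reflection in \<open>basis s\<close> changes the coordinate \<open>s\<close> only. A
  nonnegative root that it makes nonpositive therefore lies on that axis, so it is
  \<open>basis s\<close>, and \<open>w\<close> sends \<open>basis s\<close> into
  \<open>J\<close>.\<close>

lemma minimal_snoc:
  assumes w: "minimal w" and s: "\<not> supported J (act w (basis s))"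
  shows "minimal (w @ [s])"
  unfolding minimal_def
proof (rule ballI, rule ccontr)
  fix x assume x: "x \<in> J" and "\<not> nonneg (act (rev (w @ [s])) (basis x))"
  then have neg: "act (rev (w @ [s])) (basis x) q \<le> 0" for q
    using root_sign[of "rev (w @ [s])" x] by (auto simp: nonneg_def)
  have pos: "nonneg (act (rev w) (basis x))" using w x by (simp add: minimal_def)
  have "act (rev w) (basis x) q = 0" if "q \<noteq> s" for q
  proof -
    have "act (rev (w @ [s])) (basis x) q = act (rev w) (basis x) q"
      using that by (simp add: act_Cons reflection_def lincomb_def basis_def)
    then show ?thesis using neg[of q] pos by (simp add: nonneg_def order_antisym)
  qed
  then have "act (rev w) (basis x) = basis s"
    by (rule root_on_axis[OF pos])
  then have "act w (basis s) = basis x"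
    using act_rev'[of "basis x" w] by simp
  then show False using s x by simp
qed

lemma step_plain:
  assumes "minimal w" "\<not> supported J (act w (basis s))"
  shows "step s (a, family w) = (a, family (w @ [s]))"
  using assms minimal_hit by (simp add: family_snoc)

lemma step_hit:
  assumes "act w (basis s) = basis x" "x \<in> J"
  shows "step s (a, family w) = (a \<otimes> g x, family w)"
  using assms by (simp add: family_def)

section \<open>Runs along alternating words\<close>

lemma run_plain:
  assumes "minimal w" "\<And>i. i < length z \<Longrightarrow> \<not> supported J (act (w @ take i z) (basis (z ! i)))"
  shows "fold step z (a, family w) = (a, family (w @ z)) \<and> minimal (w @ z)"
  using assms
proof (induction z arbitrary: w)
  case (Cons s z)
  have s: "\<not> supported J (act w (basis s))" using Cons.prems(2)[of 0] by simp
  have "fold step z (a, family (w @ [s])) = (a, family ((w @ [s]) @ z)) \<and> minimal ((w @ [s]) @ z)"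
  proof (rule Cons.IH)
    show "minimal (w @ [s])" using minimal_snoc Cons.prems(1) s by blast
    fix i assume "i < length z"
    then show "\<not> supported J (act ((w @ [s]) @ take i z) (basis (z ! i)))"
      using Cons.prems(2)[of "Suc i"] by simp
  qed
  then show ?case using step_plain[OF Cons.prems(1) s] by simp
qed simp

lemma run_alternating_plain:
  assumes "minimal w" "\<And>i. i < k \<Longrightarrow> \<not> supported J (act w (dihedral_root s t i))"
  shows "fold step (alternating s t k) (a, family w) = (a, family (w @ alternating s t k)) \<and>
    minimal (w @ alternating s t k)"
proof (rule run_plain[OF assms(1)])
  fix i assume "i < length (alternating s t k)"
  then show "\<not> supported J (act (w @ take i (alternating s t k)) (basis (alternating s t k ! i)))"
    using assms(2)[of i]
    by (simp add: take_alternating nth_alternating act_append act_alternating_next del: if_split)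
qed

text \<open>
  After a hit at position \<open>k\<close> the run continues as if the letter at that position were deleted, and
  deleting it amounts to multiplying by the reflection in the \<open>k\<close>-th root of the dihedral subgroup.
\<close>

lemma run_single_hit:
  assumes w: "minimal w" and k: "k < m"
    and hit: "supported J (act w (dihedral_root s t k))"
    and unique: "\<And>i. i < m \<Longrightarrow> i \<noteq> k \<Longrightarrow> \<not> supported J (act w (dihedral_root s t i))"
  shows "\<exists>x\<in>J. act w (dihedral_root s t k) = basis x \<and>
    fold step (alternating s t m) (a, family w) = (a \<otimes> g x,
      \<lambda>q. act w (reflection (dihedral_root s t k) (act (alternating s t m) (basis q))))"
proof -
  define u where "u = alternating s t k"
  define l where "l = (if even k then s else t)"
  define z where "z = (if even k then alternating t s (m - Suc k) else alternating s t (m - Suc k))"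
  let ?r = "dihedral_root s t k"
  have alt_split: "alternating s t m = u @ [l] @ z"
    using alternating_append[of s t k "Suc (m - Suc k)"] k unfolding u_def l_def z_def
    by (cases "even k") simp_all
  have root: "act u (basis l) = ?r"
    unfolding u_def l_def by (rule act_alternating_next)
  have norm: "form ?r ?r = 1"
    by (simp flip: root)
  have run_u: "fold step u (a, family w) = (a, family (w @ u))" "minimal (w @ u)"
    using run_alternating_plain[OF w, of k s t a] unique k unfolding u_def by auto
  have "supported J (act (w @ u) (basis l))" using hit by (simp add: act_append root)
  then obtain x where x: "x \<in> J" "act (w @ u) (basis l) = basis x"
    using simple_if_supported[of J "w @ u" l] run_u(2) by (auto simp: minimal_def)
  then have wx: "act w ?r = basis x" by (simp add: act_append root)
  have del: "act (u @ z') v = reflection ?r (act (u @ [l] @ z') v)" if "fin_supp v" for z' v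
    using that norm by (simp add: act_append act_Cons act_reflection root reflection_reflection)
  have run_z: "fold step z (a \<otimes> g x, family (w @ u)) = (a \<otimes> g x, family ((w @ u) @ z))"
  proof (rule conjunct1[OF run_plain[OF run_u(2)]])
    fix i assume i: "i < length z"
    let ?b = "dihedral_root s t (k + Suc i)"
    have i': "k + Suc i < m" using i by (auto simp: z_def split: if_splits)
    have len: "length u = k" by (simp add: u_def)
    have "act (u @ [l] @ take i z) (basis (z ! i)) = ?b"
    proof -
      have "u @ [l] @ take i z = take (k + Suc i) (alternating s t m)"
        unfolding alt_split using len by simp
      moreover have "z ! i = alternating s t m ! (k + Suc i)"
        unfolding alt_split using len by (simp add: nth_append)
      ultimately show ?thesis
        using i' act_alternating_next[of s t "k + Suc i"]
        by (simp only: take_alternating nth_alternating less_imp_le)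
    qed
    then have "act ((w @ u) @ take i z) (basis (z ! i)) = act w (reflection ?r ?b)"
      using del[of "basis (z ! i)" "take i z"] by (simp add: act_append)
    \<comment> \<open>Since \<open>w\<close> carries \<open>?r\<close> to \<open>basis x\<close>,
      the roots tested after the hit are the original ones reflected in \<open>basis x\<close>. This
      reflection preserves support in \<open>J\<close>, so no further hit arises.\<close>
    also have "\<dots> = act [x] (act w ?b)"
      by (simp add: act_reflection wx act_Cons)
    finally have eq: "act ((w @ u) @ take i z) (basis (z ! i)) = act [x] (act w ?b)" .
    show "\<not> supported J (act ((w @ u) @ take i z) (basis (z ! i)))"
    proof
      assume "supported J (act ((w @ u) @ take i z) (basis (z ! i)))"
      then have "supported J (act [x] (act w ?b))"
        by (simp only: eq)
      then have "supported J (act [x] (act [x] (act w ?b)))"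
        using x(1) supported_act[of "[x]" J "act [x] (act w ?b)"] by simp
      then have "supported J (act w ?b)"
        using act_double[of "act w ?b" x] by (simp add: act_Cons)
      then show False using unique[of "k + Suc i"] i' by simp
    qed
  qed
  have "family ((w @ u) @ z) = (\<lambda>q. act w (reflection ?r (act (alternating s t m) (basis q))))"
  proof
    fix q
    show "family ((w @ u) @ z) q = act w (reflection ?r (act (alternating s t m) (basis q)))"
      using del[of "basis q" z] by (simp add: family_def act_append alt_split)
  qed
  then have "fold step (alternating s t m) (a, family w) = (a \<otimes> g x,
      \<lambda>q. act w (reflection ?r (act (alternating s t m) (basis q))))"
    using run_u(1) run_z step_hit[OF x(2,1), of a] by (simp add: alt_split del: step.simps)
  then show ?thesis using wx x(1) by blast
qed

text \<open>Every letter hits, so the coset never moves and the emitted letters alternate as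
  well.\<close>

lemma run_loop:
  assumes "act w (basis s) = basis x" "act w (basis t) = basis y" "x \<in> J" "y \<in> J" "a \<in> carrier G"
  shows "fold step (alternating s t n) (a, family w) =
    (a \<otimes> word_prod G g (alternating x y n), family w)"
  using assms
proof (induction n arbitrary: s t x y a)
  case (Suc n)
  have closed: "word_prod G g (alternating y x n) \<in> carrier G"
    using alternating_subset[of y J x n] Suc.prems by (intro word_prod_closed) auto
  show ?case
    using Suc.IH[of t y s x "a \<otimes> g x"] step_hit[OF Suc.prems(1,3), of a] Suc.prems closed
    by (simp add: m_assoc del: step.simps)
qed simp

text \<open>Two different positive roots of the dihedral subgroup span the plane: their determinant
  is \<open>dihedral_coeff s t (j - i)\<close>, which is positive.\<close>

lemma supported_two_roots:
  assumes st: "s \<noteq> t" and m: "N s t = enat m" and ij: "i < j" "j < m"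
    and i: "supported J (act w (dihedral_root s t i))"
    and j: "supported J (act w (dihedral_root s t j))"
  shows "supported J (act w (basis s)) \<and> supported J (act w (basis t))"
proof -
  let ?p = "dihedral_coeff s t"
  have det: "?p (Suc i) * ?p j - ?p i * ?p (Suc j) = ?p (j - i)"
    using chebyshev_det[of _ i "j - i"] ij by (simp add: dihedral_coeff_def)
  have pos: "0 < ?p (j - i)" using dihedral_coeff_pos[OF st] ij m by simp
  have "act w (basis s) q = 0 \<and> act w (basis t) q = 0" if "q \<notin> J" for q
  proof -
    let ?a = "act w (basis s) q" and ?b = "act w (basis t) q"
    have *: "?p (Suc n) * ?a + ?p n * ?b = 0" if "supported J (act w (dihedral_root s t n))" for n
      using that \<open>q \<notin> J\<close>
      by (simp add: dihedral_root_def act_lincomb supported_def) (auto simp: lincomb_def)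
    have "?p (j - i) * ?a = ?p j * (?p (Suc i) * ?a + ?p i * ?b) - ?p i * (?p (Suc j) * ?a + ?p j * ?b)"
      "?p (j - i) * ?b = ?p (Suc i) * (?p (Suc j) * ?a + ?p j * ?b) - ?p (Suc j) * (?p (Suc i) * ?a + ?p i * ?b)"
      by (simp_all add: algebra_simps flip: det)
    then have "?p (j - i) * ?a = 0" "?p (j - i) * ?b = 0"
      unfolding *[OF i] *[OF j] by simp_all
    then show ?thesis using pos by simp
  qed
  then show ?thesis by (auto simp: supported_def)
qed

text \<open>Both runs test the same \<open>m\<close> roots, in opposite order. If two of them hit,
  all do and the braid relation of \<open>g\<close> applies. If one hits, both runs emit the label
  of that root and continue with it reflected away. If none hits, only \<open>act_braid\<close> is
  needed.\<close>

theorem run_braid: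
  assumes st: "s \<noteq> t" and m: "N s t = enat m" and z: "z \<in> states"
  shows "fold step (alternating s t m) z = fold step (alternating t s m) z"
proof -
  obtain a w where a: "a \<in> carrier G" and w: "minimal w" and z_eq: "z = (a, family w)"
    using z by (auto simp: states_def)
  let ?S = "\<lambda>k. supported J (act w (dihedral_root s t k))"
  have m': "N t s = enat m" using m by (simp add: N_sym)
  have refl: "dihedral_root t s i = dihedral_root s t (m - Suc i)" if "i < m" for i
    using dihedral_root_reflect[OF st[symmetric] m' that] by simp
  show ?thesis
  proof (cases "supported J (act w (basis s)) \<and> supported J (act w (basis t))")
    case True
    then obtain x y where xy: "x \<in> J" "y \<in> J" "act w (basis s) = basis x" "act w (basis t) = basis y"
      using simple_if_supported[of J w] w unfolding minimal_def by metis
    have "x \<noteq> y"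
      using xy st act_inj[of "basis s" "basis t" w] by auto
    moreover have "gram x y = gram s t"
      using form_root[of w s t] xy by simp
    ultimately have "N x y = enat m"
      using gram_inject[of x y s t] st m by simp
    then have "word_prod G g (alternating x y m) = word_prod G g (alternating y x m)"
      using g_braid xy \<open>x \<noteq> y\<close> by blast
    then show ?thesis
      using run_loop[of w s x t y a m] run_loop[of w t y s x a m] xy a z_eq by simp
  next
    case False
    then have unique: "i = j" if "?S i" "?S j" "i < m" "j < m" for i j
      using supported_two_roots[OF st m, of i j w] supported_two_roots[OF st m, of j i w] that
      by (meson nat_neq_iff)
    show ?thesis
    proof (cases "\<exists>k<m. ?S k")
      case True
      then obtain k where k: "k < m" "?S k" by blast
      have other: "\<not> ?S i" if "i < m" "i \<noteq> k" for i using unique k that by blast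
      let ?k = "m - Suc k"
      have root: "dihedral_root t s ?k = dihedral_root s t k"
        using refl[of ?k] k by simp
      obtain x where x: "x \<in> J" "act w (dihedral_root s t k) = basis x"
        "fold step (alternating s t m) (a, family w) = (a \<otimes> g x,
          \<lambda>q. act w (reflection (dihedral_root s t k) (act (alternating s t m) (basis q))))"
        using run_single_hit[OF w k other, of a] by auto
      have "\<not> supported J (act w (dihedral_root t s i))" if "i < m" "i \<noteq> ?k" for i
      proof -
        have "m - Suc i \<noteq> k" using that by auto
        then show ?thesis using refl[OF that(1)] other[of "m - Suc i"] that by simp
      qed
      moreover have "?k < m" using k by simp
      ultimately obtain y where y: "y \<in> J" "act w (dihedral_root s t k) = basis y"
        "fold step (alternating t s m) (a, family w) = (a \<otimes> g y,
          \<lambda>q. act w (reflection (dihedral_root s t k) (act (alternating t s m) (basis q))))"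
        using run_single_hit[OF w, of ?k m t s a] k unfolding root by auto
      have "x = y" using x(2) y(2) by simp
      then show ?thesis
        using x(3) y(3) act_braid[OF st m] z_eq by simp
    next
      case False
      then have none: "\<not> ?S i" if "i < m" for i using that by blast
      have "\<not> supported J (act w (dihedral_root t s i))" if "i < m" for i
        using none[of "m - Suc i"] refl[OF that] that by simp
      then have "fold step (alternating t s m) (a, family w) = (a, family (w @ alternating t s m))"
        "fold step (alternating s t m) (a, family w) = (a, family (w @ alternating s t m))"
        using run_alternating_plain[OF w, of m t s a] run_alternating_plain[OF w, of m s t a] none
        by auto
      moreover have "family (w @ alternating t s m) = family (w @ alternating s t m)"
        using act_braid[OF st m] by (simp add: family_def act_append)
      ultimately show ?thesis using z_eq by simp
    qed
  qed
qed

section \<open>Invertibility of the steps\<close>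

lemma states_cases:
  assumes "z \<in> states"
  obtains (hit) a w x where "z = (a, family w)" "a \<in> carrier G" "minimal w" "x \<in> J"
      "act w (basis s) = basis x"
    | (plain) a w where "z = (a, family w)" "a \<in> carrier G" "minimal w"
      "\<not> supported J (act w (basis s))"
proof -
  obtain a w where z: "z = (a, family w)" "a \<in> carrier G" "minimal w"
    using assms by (auto simp: states_def)
  show thesis
  proof (cases "supported J (act w (basis s))")
    case True
    then obtain x where "x \<in> J" "act w (basis s) = basis x"
      using simple_if_supported[of J w s] z(3) by (auto simp: minimal_def)
    then show thesis using hit z by blast
  next
    case False
    then show thesis using plain z by blast
  qed
qed

lemma step_closed: "z \<in> states \<Longrightarrow> step s z \<in> states"
  by (erule states_cases[of z s])
    (simp_all add: step_plain step_hit minimal_snoc states_def del: step.simps)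

lemma unstep_hit:
  assumes "act w (basis s) = basis x" "x \<in> J"
  shows "unstep s (a, family w) = (a \<otimes> inv (g x), family w)"
  using assms by (simp add: family_def)

lemma unstep_plain:
  assumes "minimal w" "\<not> supported J (act w (basis s))"
  shows "unstep s (a, family w) = (a, family (w @ [s]))"
  using assms minimal_hit by (simp add: family_snoc)

lemma unstep_closed: "z \<in> states \<Longrightarrow> unstep s z \<in> states"
  by (erule states_cases[of z s])
    (simp_all add: unstep_plain unstep_hit minimal_snoc states_def del: unstep.simps)

text \<open>The second step tests the negative of the first root, so it is plain again and leads
  back.\<close>

lemma plain_twice:
  assumes "minimal w" "\<not> supported J (act w (basis s))"
  shows "minimal (w @ [s])" "\<not> supported J (act (w @ [s]) (basis s))"
    "family ((w @ [s]) @ [s]) = family w"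
  using assms minimal_snoc
  by (simp_all add: act_snoc_self supported_def) (simp add: family_def act_append act_double)

lemma unstep_step: "z \<in> states \<Longrightarrow> unstep s (step s z) = z"
  by (erule states_cases[of z s])
    (simp_all add: step_plain step_hit unstep_plain unstep_hit plain_twice m_assoc
      del: step.simps unstep.simps append_assoc)

lemma step_unstep: "z \<in> states \<Longrightarrow> step s (unstep s z) = z"
  by (erule states_cases[of z s])
    (simp_all add: step_plain step_hit unstep_plain unstep_hit plain_twice m_assoc
      del: step.simps unstep.simps append_assoc)

lemma base_state: "a \<in> carrier G \<Longrightarrow> (a, basis) \<in> states"
proof -
  have "family [] = basis" "minimal []" by (auto simp: family_def minimal_def)
  then show "a \<in> carrier G \<Longrightarrow> (a, basis) \<in> states" by (force simp: states_def)
qed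

lemma step_base:
  "x \<in> J \<Longrightarrow> step x (a, basis) = (a \<otimes> g x, basis)"
  "x \<in> J \<Longrightarrow> unstep x (a, basis) = (a \<otimes> inv (g x), basis)"
  by simp_all

end

section \<open>The action of the virtual Artin group\<close>

context coxeter_matrix
begin

definition root_pair :: "('i \<Rightarrow> real) \<Rightarrow> ('i \<Rightarrow> real) \<Rightarrow> nat \<Rightarrow> bool" where
  "root_pair b c k \<longleftrightarrow>
    (\<exists>w s t. s \<noteq> t \<and> N s t = enat k \<and> b = act w (basis s) \<and> c = act w (basis t))"

text \<open>Defined on all vectors, because the indices of a \<open>coxeter_matrix\<close> exhaust a
  type. Pairs of distinct vectors that are not a common translate of two simple roots with finite
  entry are free.\<close>

definition root_matrix :: "('i \<Rightarrow> real) \<Rightarrow> ('i \<Rightarrow> real) \<Rightarrow> enat" where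
  "root_matrix b c = (if b = c then 1
    else if \<exists>k. root_pair b c k then enat (SOME k. root_pair b c k) else \<infinity>)"

lemma root_pair_sym: "root_pair b c k \<longleftrightarrow> root_pair c b k"
  unfolding root_pair_def by (metis N_sym)

lemma root_pair_distinct:
  assumes "root_pair b c k"
  shows "b \<noteq> c"
proof
  assume "b = c"
  then obtain w s t where "s \<noteq> t" "act w (basis s) = act w (basis t)"
    using assms by (auto simp: root_pair_def)
  then show False using act_inj[of "basis s" "basis t" w] by simp
qed

text \<open>However the pair is written, the form takes the value \<open>gram\<close> of the simple
  roots used, and \<open>gram_inject\<close> recovers the entry.\<close>

lemma root_pair_unique:
  assumes "root_pair b c k" "root_pair b c l"
  shows "k = l"
proof -
  obtain w s t where 1: "s \<noteq> t" "N s t = enat k" "b = act w (basis s)" "c = act w (basis t)"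
    using assms by (auto simp: root_pair_def)
  obtain w' s' t' where 2: "s' \<noteq> t'" "N s' t' = enat l" "b = act w' (basis s')" "c = act w' (basis t')"
    using assms by (auto simp: root_pair_def)
  have "form b c = gram s t" "form b c = gram s' t'"
    unfolding 1(3,4) by (rule form_root) (simp only: 1(3,4)[symmetric] 2(3,4) form_root)
  then show ?thesis using gram_inject[of s t s' t'] 1 2 by simp
qed

lemma root_matrix_pair: "root_pair b c k \<Longrightarrow> root_matrix b c = enat k"
  using root_pair_distinct root_pair_unique someI[of "root_pair b c" k]
  by (auto simp: root_matrix_def)

lemma root_matrix_finite: "b \<noteq> c \<Longrightarrow> root_matrix b c = enat k \<Longrightarrow> root_pair b c k"
  using someI[of "root_pair b c"] by (auto simp: root_matrix_def split: if_splits)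

lemma coxeter_matrix_root_matrix: "coxeter_matrix root_matrix"
proof
  show "root_matrix b b = 1" for b by (simp add: root_matrix_def)
  show "root_matrix b c = root_matrix c b" for b c
    unfolding root_matrix_def root_pair_sym[of b c] by auto
  show "2 \<le> root_matrix b c" if bc: "b \<noteq> c" for b c
  proof (cases "root_matrix b c")
    case (enat k)
    then obtain w s t where "s \<noteq> t" "N s t = enat k"
      using root_matrix_finite[OF bc enat] by (auto simp: root_pair_def)
    then show ?thesis using N_ge_2[of s t] enat by simp
  qed simp
qed

end

section \<open>Conjugates of the generators \<sigma>, indexed by roots\<close>

context virtual_artin_system
begin

definition roots :: "('i \<Rightarrow> real) set" where
  "roots = {act u (basis x) | u x. set u \<subseteq> X \<and> x \<in> X}"

definition \<delta> :: "('i \<Rightarrow> real) \<Rightarrow> 'a" where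
  "\<delta> b = (SOME d. \<exists>u x. set u \<subseteq> X \<and> x \<in> X \<and> b = act u (basis x) \<and> d = T u \<otimes> \<sigma> x \<otimes> inv (T u))"

lemma T_rev: "set u \<subseteq> X \<Longrightarrow> T (rev u) = inv (T u)"
  using T_cong[OF cox_eq_rev_left[of u X]] T_append[of "rev u" u] by (simp add: inv_equality)

text \<open>Two ways to write the root differ by \<open>rev u' @ u\<close>, which carries one simple
  root to the other, so \<open>T_conj\<close> identifies the two conjugates.\<close>

lemma \<delta>_act:
  assumes "set u \<subseteq> X" "x \<in> X"
  shows "\<delta> (act u (basis x)) = T u \<otimes> \<sigma> x \<otimes> inv (T u)"
proof -
  let ?P = "\<lambda>d. \<exists>u' x'. set u' \<subseteq> X \<and> x' \<in> X \<and> act u (basis x) = act u' (basis x') \<and>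
    d = T u' \<otimes> \<sigma> x' \<otimes> inv (T u')"
  have "?P (\<delta> (act u (basis x)))"
    unfolding \<delta>_def by (rule someI_ex) (use assms in blast)
  then obtain u' x' where u': "set u' \<subseteq> X" "x' \<in> X" "act u (basis x) = act u' (basis x')"
    and d: "\<delta> (act u (basis x)) = T u' \<otimes> \<sigma> x' \<otimes> inv (T u')" by blast
  have "act (rev u' @ u) (basis x) = basis x'"
    using u'(3) by (simp add: act_append act_rev)
  then have "T (rev u' @ u) \<otimes> \<sigma> x = \<sigma> x' \<otimes> T (rev u' @ u)"
    using assms u' by (intro T_conj) auto
  then have *: "inv (T u') \<otimes> T u \<otimes> \<sigma> x = \<sigma> x' \<otimes> (inv (T u') \<otimes> T u)"
    using assms u' by (simp add: T_append T_rev)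
  have "T u \<otimes> \<sigma> x \<otimes> inv (T u) = T u' \<otimes> (inv (T u') \<otimes> T u \<otimes> \<sigma> x) \<otimes> inv (T u)"
    using assms u' by (simp add: m_assoc)
  also have "\<dots> = T u' \<otimes> \<sigma> x' \<otimes> inv (T u')"
    unfolding * using assms u' by (simp add: m_assoc)
  finally show ?thesis using d by simp
qed

lemma word_prod_\<delta>:
  assumes u: "set u \<subseteq> X" and "set w \<subseteq> X"
  shows "word_prod G \<delta> (map (\<lambda>x. act u (basis x)) w) = T u \<otimes> word_prod G \<sigma> w \<otimes> inv (T u)"
  using assms(2)
proof (induction w)
  case Nil
  then show ?case using u by simp
next
  case (Cons x w)
  have "word_prod G \<sigma> w \<in> carrier G" using Cons.prems by (intro word_prod_closed) auto
  then show ?case using Cons u by (simp add: \<delta>_act m_assoc)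
qed

lemma supported_roots: "b \<in> roots \<Longrightarrow> supported X b"
  unfolding roots_def using supported_act[of _ X] by fastforce

text \<open>By \<open>parabolic_roots\<close> a single \<open>u\<close> over \<open>X\<close> makes
  both roots simple, and the form shows that the entry stays the same. The braid relation is then
  that of \<open>\<sigma>\<close>, conjugated by \<open>T u\<close>.\<close>

lemma emission_roots: "emission root_matrix G roots \<delta>"
proof (intro emission.intro coxeter_matrix_root_matrix is_group emission_axioms.intro)
  show "\<delta> b \<in> carrier G" if "b \<in> roots" for b
    using that by (auto simp: roots_def \<delta>_act)
  show "word_prod G \<delta> (alternating b c k) = word_prod G \<delta> (alternating c b k)"
    if bc: "b \<in> roots" "c \<in> roots" "b \<noteq> c" "root_matrix b c = enat k" for b c k
  proof -
    have pair: "root_pair b c k" using root_matrix_finite bc by blast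
    then obtain w s t where w: "b = act w (basis s)" "c = act w (basis t)"
      by (auto simp: root_pair_def)
    obtain u x y where u: "set u \<subseteq> X" "x \<in> X" "y \<in> X" "b = act u (basis x)" "c = act u (basis y)"
      using parabolic_roots[of X w s t] supported_roots bc w by metis
    have "x \<noteq> y" using u bc by auto
    have "N x y = enat k"
    proof -
      obtain w s t where st: "s \<noteq> t" "N s t = enat k" "b = act w (basis s)" "c = act w (basis t)"
        using pair by (auto simp: root_pair_def)
      have "form b c = gram x y" "form b c = gram s t"
        unfolding u(4,5) by (rule form_root) (simp only: u(4,5)[symmetric] st(3,4) form_root)
      then show ?thesis using gram_inject[of x y s t] \<open>x \<noteq> y\<close> st by simp
    qed
    then have "word_prod G \<sigma> (alternating x y k) = word_prod G \<sigma> (alternating y x k)"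
      using \<sigma>_braid u \<open>x \<noteq> y\<close> by blast
    then show ?thesis
      using word_prod_\<delta>[OF u(1), of "alternating x y k"] word_prod_\<delta>[OF u(1), of "alternating y x k"]
        alternating_subset[OF u(2,3)] alternating_subset[OF u(3,2)] u
      by (simp add: map_alternating)
  qed
qed

end

text \<open>The construction is used one level up: the indices are now vectors \<open>b\<close>,
  each with a formal simple root \<open>basis b\<close> of its own.\<close>

sublocale virtual_artin_system \<subseteq> hat: emission root_matrix G roots \<delta>
  by (rule emission_roots)

section \<open>The action of letters on positions\<close>

context virtual_artin_system
begin

text \<open>If \<open>c\<close> is the family of \<open>w\<close>, then \<open>c s\<close> is the
  root \<open>w \<alpha>\<^sub>s\<close>, the index of the generator by which \<sigma> acts. Both
  signs of \<tau> act alike, as reflections are involutions.\<close>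

fun letter_step :: "'i va_gen letter \<Rightarrow>
    ('a \<times> (('i \<Rightarrow> real) \<Rightarrow> ('i \<Rightarrow> real) \<Rightarrow> real)) \<times> ('i \<Rightarrow> 'i \<Rightarrow> real) \<Rightarrow>
    ('a \<times> (('i \<Rightarrow> real) \<Rightarrow> ('i \<Rightarrow> real) \<Rightarrow> real)) \<times> ('i \<Rightarrow> 'i \<Rightarrow> real)" where
  "letter_step (Pos (SigmaGen s)) (z, c) = (hat.step (c s) z, c)"
| "letter_step (Neg (SigmaGen s)) (z, c) = (hat.unstep (c s) z, c)"
| "letter_step (Pos (TauGen s)) (z, c) = (z, column_op s c)"
| "letter_step (Neg (TauGen s)) (z, c) = (z, column_op s c)"

definition positions where "positions = hat.states \<times> range family"

lemma family_twice: "column_op s (column_op s (family w)) = family w"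
proof -
  have "family ((w @ [s]) @ [s]) = family w"
    by (simp add: family_def act_append act_Cons reflection_reflection)
  then show ?thesis by (simp only: family_snoc)
qed

lemma letter_step_closed: "p \<in> positions \<Longrightarrow> letter_step a p \<in> positions"
  by (cases "(a, p)" rule: letter_step.cases)
    (auto simp: positions_def hat.step_closed hat.unstep_closed simp flip: family_snoc)

lemma fold_letter_closed: "p \<in> positions \<Longrightarrow> fold letter_step w p \<in> positions"
  by (induction w arbitrary: p) (auto simp: letter_step_closed)

lemma letter_step_inverse:
  assumes "p \<in> positions"
  shows "fold letter_step [Pos a, Neg a] p = p" "fold letter_step [Neg a, Pos a] p = p"
  using assms
  by (cases a; auto simp: positions_def hat.step_unstep hat.unstep_step family_twice
      simp del: hat.step.simps hat.unstep.simps)+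

lemma fold_letter_sigma:
  "fold letter_step (map Pos (map SigmaGen w)) (z, c) = (fold hat.step (map c w) z, c)"
  by (induction w arbitrary: z) (auto simp del: hat.step.simps)

lemma fold_letter_tau:
  "fold letter_step (map Pos (map TauGen w)) (z, family u) = (z, family (u @ w))"
proof (induction w arbitrary: u)
  case (Cons a w)
  show ?case using Cons[of "u @ [a]"] by (simp flip: family_snoc)
qed simp

text \<open>Relation v1 is \<open>hat.run_braid\<close> for the two roots, v2 holds in the Coxeter
  group, and v3 holds because both sides use the same root for their letter \<sigma>.\<close>

lemma fold_letter_relation:
  assumes \<Gamma>: "\<And>s t. s \<in> vertices \<Gamma> \<Longrightarrow> t \<in> vertices \<Gamma> \<Longrightarrow> cox_m \<Gamma> s t = N s t"
    and "(u, v) \<in> va_relations \<Gamma>" and p: "p \<in> positions"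
  shows "fold letter_step (map Pos u) p = fold letter_step (map Pos v) p"
proof -
  obtain z w where z: "z \<in> hat.states" and p: "p = (z, family w)"
    using p by (auto simp: positions_def)
  from assms(2) show ?thesis
  proof cases
    case (v1 s t k)
    then have k: "N s t = enat k" using \<Gamma> by simp
    then have pair: "root_pair (family w s) (family w t) k"
      using v1 by (auto simp: root_pair_def family_def)
    have "fold hat.step (alternating (family w s) (family w t) k) z =
        fold hat.step (alternating (family w t) (family w s) k) z"
      by (rule hat.run_braid[OF root_pair_distinct[OF pair] root_matrix_pair[OF pair] z])
    then show ?thesis
      using fold_letter_sigma[of "alternating s t k" z "family w"]
        fold_letter_sigma[of "alternating t s k" z "family w"]
      by (simp add: v1 p map_alternating del: map_map)
  next
    case (v2_square s)
    then show ?thesis by (simp add: p family_twice)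
  next
    case (v2_braid s t k)
    then have "family (w @ alternating s t k) = family (w @ alternating t s k)"
      using act_braid[of s t k] \<Gamma> by (simp add: family_def act_append)
    then show ?thesis
      using fold_letter_tau[of "alternating s t k" z w] fold_letter_tau[of "alternating t s k" z w]
      by (simp add: v2_braid p map_alternating del: map_map)
  next
    case (v3 s t k r)
    then have k: "N t s = enat k" using \<Gamma> N_sym by simp
    let ?w = "alternating t s (k - 1)"
    have "2 \<le> k" using finite_entry_ge_2 v3 k by metis
    \<comment> \<open>Thus \<open>r\<close> is the letter that would follow \<open>?w\<close>, and
      the root at that place is the last positive one, \<open>basis s\<close>.\<close>
    then have "r = (if even (k - 1) then t else s)" using v3 by auto
    then have "act ?w (basis r) = basis s"
      using act_alternating_next[of t s "k - 1"] dihedral_root_end(1)[of t s k] v3 k by simp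
    then have "family (w @ ?w) r = family w s"
      by (simp add: family_def act_append)
    moreover have "fold letter_step (map Pos (alternating (TauGen t) (TauGen s) (k - 1))) (z', family w)
        = (z', family (w @ ?w))" for z'
      using fold_letter_tau[of ?w z' w] by (simp add: map_alternating del: map_map)
    ultimately show ?thesis
      by (simp add: v3(1,2) p del: hat.step.simps)
  qed
qed

lemma fold_letter_word_cong:
  assumes \<Gamma>: "\<And>s t. s \<in> vertices \<Gamma> \<Longrightarrow> t \<in> vertices \<Gamma> \<Longrightarrow> cox_m \<Gamma> s t = N s t"
    and "(u, v) \<in> word_cong (va_gens \<Gamma>) (va_rels \<Gamma>)" and "p \<in> positions"
  shows "fold letter_step u p = fold letter_step v p"
  using assms(2,3)
proof (induction arbitrary: p)
  case (rel u v)
  then obtain u' v' where "(u', v') \<in> va_relations \<Gamma>" "u = map Pos u'" "v = map Pos v'"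
    by (auto simp: va_rels_def)
  then show ?case using fold_letter_relation[OF \<Gamma> _ rel.prems] by simp
next
  case (append u u' v v')
  then show ?case using fold_letter_closed by simp
qed (simp_all only: letter_step_inverse fold_Nil id_apply)

fun gen_value :: "'i va_gen \<Rightarrow> 'a" where
  "gen_value (SigmaGen x) = \<sigma> x"
| "gen_value (TauGen x) = \<tau> x"

lemma inv_\<tau>: "x \<in> X \<Longrightarrow> inv (\<tau> x) = \<tau> x"
  by (rule inv_equality) (simp_all add: \<tau>_square)

text \<open>Over \<open>X\<close> only roots of \<open>X\<close> occur, so every \<sigma> hits and
  the inner coset stays at \<open>basis\<close>. Appending the conjugate
  \<open>T u \<otimes> \<sigma> x \<otimes> inv (T u)\<close> to \<open>a\<close> multiplies
  \<open>a \<otimes> T u\<close> by \<open>\<sigma> x\<close>.\<close>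

lemma fold_letter_value:
  assumes "w \<in> group_words (SigmaGen ` X \<union> TauGen ` X)" "a \<in> carrier G" "set u \<subseteq> X"
  shows "\<exists>a'\<in>carrier G. \<exists>u'. set u' \<subseteq> X \<and>
    fold letter_step w ((a, basis), family u) = ((a', basis), family u') \<and>
    a \<otimes> T u \<otimes> eval_word G gen_value w = a' \<otimes> T u'"
  using assms
proof (induction w arbitrary: a u)
  case Nil
  then show ?case by (intro bexI[of _ a] exI[of _ u]) auto
next
  case (Cons l w)
  let ?A = "SigmaGen ` X \<union> TauGen ` X"
  have w: "w \<in> group_words ?A" using Cons.prems(1) by (cases l) auto
  have gen: "gen_value ` ?A \<subseteq> carrier G" by auto
  have e: "eval_word G gen_value w \<in> carrier G"
    by (rule eval_word_closed[OF is_group gen w])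
  have "\<exists>a1\<in>carrier G. \<exists>u1. set u1 \<subseteq> X \<and>
    letter_step l ((a, basis), family u) = ((a1, basis), family u1) \<and>
    a \<otimes> T u \<otimes> eval_word G gen_value [l] = a1 \<otimes> T u1 \<and> eval_word G gen_value [l] \<in> carrier G"
  proof -
    have root: "family u x \<in> roots" "\<delta> (family u x) = T u \<otimes> \<sigma> x \<otimes> inv (T u)" if "x \<in> X" for x
      using that Cons.prems(3) \<delta>_act by (auto simp: roots_def family_def)
    have tau: "T (u @ [x]) = T u \<otimes> \<tau> x" if "x \<in> X" for x
      using that Cons.prems(3) by (simp add: T_append)
    consider (sp) x where "l = Pos (SigmaGen x)" "x \<in> X" | (sn) x where "l = Neg (SigmaGen x)" "x \<in> X"
      | (t) x where "l = Pos (TauGen x) \<or> l = Neg (TauGen x)" "x \<in> X"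
      using Cons.prems(1) by (cases l) auto
    then show ?thesis
    proof cases
      case sp
      then show ?thesis
        using root[OF sp(2)] Cons.prems
        by (intro bexI[of _ "a \<otimes> \<delta> (family u x)"] exI[of _ u])
          (auto simp: hat.step_base m_assoc simp del: hat.step.simps)
    next
      case sn
      then show ?thesis
        using root[OF sn(2)] Cons.prems
        by (intro bexI[of _ "a \<otimes> inv (\<delta> (family u x))"] exI[of _ u])
          (auto simp: hat.step_base m_assoc inv_mult_group simp del: hat.unstep.simps)
    next
      case t
      then show ?thesis
        using tau[OF t(2)] Cons.prems
        by (intro bexI[of _ a] exI[of _ "u @ [x]"])
          (auto simp: inv_\<tau> m_assoc family_snoc)
    qed
  qed
  then obtain a1 u1 where 1: "a1 \<in> carrier G" "set u1 \<subseteq> X"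
    "letter_step l ((a, basis), family u) = ((a1, basis), family u1)"
    "a \<otimes> T u \<otimes> eval_word G gen_value [l] = a1 \<otimes> T u1" "eval_word G gen_value [l] \<in> carrier G"
    by blast
  obtain a' u' where 2: "a' \<in> carrier G" "set u' \<subseteq> X"
    "fold letter_step w ((a1, basis), family u1) = ((a', basis), family u')"
    "a1 \<otimes> T u1 \<otimes> eval_word G gen_value w = a' \<otimes> T u'"
    using Cons.IH[OF w 1(1,2)] by blast
  have "eval_word G gen_value (l # w) = eval_word G gen_value [l] \<otimes> eval_word G gen_value w"
    using eval_word_append[OF is_group gen, of "[l]" w] Cons.prems(1) w by (cases l) auto
  then have "a \<otimes> T u \<otimes> eval_word G gen_value (l # w) = a' \<otimes> T u'"
    using 1 2 e Cons.prems by (simp add: m_assoc[symmetric])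
  then show ?case using 1(3) 2 by (intro bexI[of _ a'] exI[of _ u']) auto
qed

text \<open>Congruent words lead from the base position to the same position. Equality of the
  families holds in the large Coxeter group; \<open>act_faithful\<close> brings it down to
  \<open>X\<close>, so the values of \<open>T\<close> agree too.\<close>

theorem eval_word_cong:
  assumes \<Gamma>: "\<And>s t. s \<in> vertices \<Gamma> \<Longrightarrow> t \<in> vertices \<Gamma> \<Longrightarrow> cox_m \<Gamma> s t = N s t"
    and uv: "(u, v) \<in> word_cong (va_gens \<Gamma>) (va_rels \<Gamma>)"
    and u: "u \<in> group_words (SigmaGen ` X \<union> TauGen ` X)"
    and v: "v \<in> group_words (SigmaGen ` X \<union> TauGen ` X)"
  shows "eval_word G gen_value u = eval_word G gen_value v"
proof -
  let ?p = "((\<one>, basis), family [])"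
  have p: "?p \<in> positions" by (simp add: positions_def hat.base_state)
  have closed: "eval_word G gen_value w \<in> carrier G" if "w \<in> {u, v}" for w
    by (rule eval_word_closed[OF is_group _, of _ "SigmaGen ` X \<union> TauGen ` X"]) (use that u v in auto)
  obtain a u' where 1: "a \<in> carrier G" "set u' \<subseteq> X" "fold letter_step u ?p = ((a, basis), family u')"
    "\<one> \<otimes> T [] \<otimes> eval_word G gen_value u = a \<otimes> T u'"
    using fold_letter_value[OF u, of \<one> "[]"] by auto
  obtain b v' where 2: "b \<in> carrier G" "set v' \<subseteq> X" "fold letter_step v ?p = ((b, basis), family v')"
    "\<one> \<otimes> T [] \<otimes> eval_word G gen_value v = b \<otimes> T v'"
    using fold_letter_value[OF v, of \<one> "[]"] by auto
  have "fold letter_step u ?p = fold letter_step v ?p"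
    by (rule fold_letter_word_cong[OF \<Gamma> uv p])
  then have "a = b" and eq: "family u' = family v'" using 1(3) 2(3) by simp_all
  have "cox_eq X u' v'"
    by (rule act_faithful) (use 1 2 fun_cong[OF eq] in \<open>auto simp: family_def\<close>)
  then have "T u' = T v'" by (rule T_cong)
  then show ?thesis using 1(4) 2(4) \<open>a = b\<close> closed by simp
qed

end

section \<open>Transfer to the presented groups\<close>

lemma eval_word_Pos: "eval_word G f (map Pos w) = word_prod G f w"
  by (induction w) auto

lemma word_prod_map: "word_prod G f (map h w) = word_prod G (\<lambda>x. f (h x)) w"
  by (induction w) auto

text \<open>Vertices outside of the graph are made free, so that a Coxeter matrix on the whole type results.\<close>

definition total_matrix :: "'s coxeter_graph \<Rightarrow> 's \<Rightarrow> 's \<Rightarrow> enat" where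
  "total_matrix \<Gamma> s t = (if s = t then 1
    else if s \<in> vertices \<Gamma> \<and> t \<in> vertices \<Gamma> then cox_m \<Gamma> s t else \<infinity>)"

lemma total_matrix_vertices:
  "is_coxeter_graph \<Gamma> \<Longrightarrow> s \<in> vertices \<Gamma> \<Longrightarrow> t \<in> vertices \<Gamma> \<Longrightarrow> cox_m \<Gamma> s t = total_matrix \<Gamma> s t"
  by (simp add: total_matrix_def is_coxeter_graph_def)

lemma coxeter_matrix_total_matrix: "is_coxeter_graph \<Gamma> \<Longrightarrow> coxeter_matrix (total_matrix \<Gamma>)"
  by unfold_locales (auto simp: total_matrix_def is_coxeter_graph_def)

lemma VA_relation:
  assumes "(u, v) \<in> va_relations \<Gamma>"
  shows "word_prod (VA \<Gamma>) (presented_gen (va_gens \<Gamma>) (va_rels \<Gamma>)) u =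
    word_prod (VA \<Gamma>) (presented_gen (va_gens \<Gamma>) (va_rels \<Gamma>)) v"
proof -
  have "(map Pos u, map Pos v) \<in> va_rels \<Gamma>" using assms by (force simp: va_rels_def)
  then show ?thesis
    using presented_group_relation[OF va_rels_words] unfolding VA_def eval_word_Pos[symmetric] by blast
qed

lemma virtual_artin_system_VA:
  assumes \<Gamma>: "is_coxeter_graph \<Gamma>" and X: "X \<subseteq> vertices \<Gamma>"
  defines "\<Delta> \<equiv> full_subgraph \<Gamma> X"
  shows "virtual_artin_system (total_matrix \<Gamma>) (VA \<Delta>) X (va_sigma \<Delta>) (va_tau \<Delta>)"
proof -
  interpret group "VA \<Delta>" by (rule group_VA)
  let ?gen = "presented_gen (va_gens \<Delta>) (va_rels \<Delta>)"
  have sigma: "word_prod (VA \<Delta>) (va_sigma \<Delta>) w = word_prod (VA \<Delta>) ?gen (map SigmaGen w)"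
    and tau: "word_prod (VA \<Delta>) (va_tau \<Delta>) w = word_prod (VA \<Delta>) ?gen (map TauGen w)" for w
    by (simp_all add: word_prod_map va_sigma_def[abs_def] va_tau_def[abs_def])
  have vert: "vertices \<Delta> = X" by (simp add: \<Delta>_def full_subgraph_def)
  have m: "cox_m \<Delta> x y = enat k"
    if "x \<in> X" "y \<in> X" "total_matrix \<Gamma> x y = enat k" for x y k
    using that X total_matrix_vertices[OF \<Gamma>, of x y] by (auto simp: \<Delta>_def full_subgraph_def)
  show ?thesis
  proof (intro virtual_artin_system.intro coxeter_matrix_total_matrix[OF \<Gamma>] group_VA
      virtual_artin_system_axioms.intro)
    fix x assume x: "x \<in> X"
    show "va_sigma \<Delta> x \<in> carrier (VA \<Delta>)" "va_tau \<Delta> x \<in> carrier (VA \<Delta>)"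
      using x by (simp_all add: va_sigma_in_VA va_tau_in_VA vert)
    then show "va_tau \<Delta> x \<otimes>\<^bsub>VA \<Delta>\<^esub> va_tau \<Delta> x = \<one>\<^bsub>VA \<Delta>\<^esub>"
      using VA_relation[OF va_relations.v2_square[of x \<Delta>]] x tau[of "[x, x]"] by (simp add: vert)
    fix y k assume y: "y \<in> X" "x \<noteq> y" "total_matrix \<Gamma> x y = enat k"
    note rel = x y(1) y(2) m[OF x y(1,3)]
    show "word_prod (VA \<Delta>) (va_sigma \<Delta>) (alternating x y k) =
        word_prod (VA \<Delta>) (va_sigma \<Delta>) (alternating y x k)"
      unfolding sigma map_alternating
      by (rule VA_relation[OF va_relations.v1]) (use rel vert in auto)
    show "word_prod (VA \<Delta>) (va_tau \<Delta>) (alternating x y k) =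
        word_prod (VA \<Delta>) (va_tau \<Delta>) (alternating y x k)"
      unfolding tau map_alternating
      by (rule VA_relation[OF va_relations.v2_braid]) (use rel vert in auto)
    let ?r = "if even k then x else y"
    let ?w = "alternating (TauGen y) (TauGen x) (k - 1)"
    have r: "?r \<in> X" using x y by simp
    have closed: "?gen a \<in> carrier (VA \<Delta>)" if "a \<in> set ?w \<union> {SigmaGen ?r}" for a
      unfolding VA_def
      by (rule presented_gen_in_carrier)
        (use that set_alternating[of "TauGen y" "TauGen x" "k - 1"] x y r in \<open>auto simp: va_gens_def vert\<close>)
    have "word_prod (VA \<Delta>) ?gen ([SigmaGen x] @ ?w) = word_prod (VA \<Delta>) ?gen (?w @ [SigmaGen ?r])"
      by (rule VA_relation[OF va_relations.v3]) (use rel vert in auto)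
    also have "\<dots> = word_prod (VA \<Delta>) ?gen ?w \<otimes>\<^bsub>VA \<Delta>\<^esub> word_prod (VA \<Delta>) ?gen [SigmaGen ?r]"
      using closed by (intro word_prod_append) auto
    finally show "va_sigma \<Delta> x \<otimes>\<^bsub>VA \<Delta>\<^esub> word_prod (VA \<Delta>) (va_tau \<Delta>) (alternating y x (k - 1)) =
      word_prod (VA \<Delta>) (va_tau \<Delta>) (alternating y x (k - 1)) \<otimes>\<^bsub>VA \<Delta>\<^esub> va_sigma \<Delta> ?r"
      unfolding tau map_alternating using closed by (simp add: va_sigma_def)
  qed
qed

text \<open>Injectivity of the natural homomorphism, in terms of words.\<close>

lemma VA_class_cong:
  assumes \<Gamma>: "is_coxeter_graph \<Gamma>" and X: "X \<subseteq> vertices \<Gamma>"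
  defines "\<Delta> \<equiv> full_subgraph \<Gamma> X"
  assumes u: "u \<in> group_words (va_gens \<Delta>)" and v: "v \<in> group_words (va_gens \<Delta>)"
    and uv: "(u, v) \<in> word_cong (va_gens \<Gamma>) (va_rels \<Gamma>)"
  shows "word_class (va_gens \<Delta>) (va_rels \<Delta>) u = word_class (va_gens \<Delta>) (va_rels \<Delta>) v"
proof -
  interpret virtual_artin_system "total_matrix \<Gamma>" "VA \<Delta>" X "va_sigma \<Delta>" "va_tau \<Delta>"
    unfolding \<Delta>_def by (rule virtual_artin_system_VA[OF \<Gamma> X])
  have gens: "va_gens \<Delta> = SigmaGen ` X \<union> TauGen ` X"
    by (simp add: va_gens_def \<Delta>_def full_subgraph_def)
  \<comment> \<open>With these generators \<open>gen_value\<close> is the tautological assignment,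
    so a word evaluates to its own class.\<close>
  have "gen_value = presented_gen (va_gens \<Delta>) (va_rels \<Delta>)"
  proof
    show "gen_value a = presented_gen (va_gens \<Delta>) (va_rels \<Delta>) a" for a
      by (cases a) (simp_all add: va_sigma_def va_tau_def)
  qed
  moreover have "eval_word (VA \<Delta>) gen_value u = eval_word (VA \<Delta>) gen_value v"
    by (rule eval_word_cong[OF total_matrix_vertices[OF \<Gamma>] uv]) (use u v gens in auto)
  ultimately show ?thesis
    using eval_presented_gen[OF va_rels_words u] eval_presented_gen[OF va_rels_words v]
    by (simp add: VA_def)
qed

lemma va_gens_generators:
  "presented_gen (va_gens \<Gamma>) (va_rels \<Gamma>) ` (SigmaGen ` X \<union> TauGen ` X) = va_sigma \<Gamma> ` X \<union> va_tau \<Gamma> ` X"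
  by (auto simp: va_sigma_def va_tau_def)

theorem theorem1p1:
  fixes \<Gamma> :: "'s coxeter_graph" and X :: "'s set"
  assumes "is_coxeter_graph \<Gamma>"
    and "X \<subseteq> vertices \<Gamma>"
  shows "(\<exists>h. is_natural_hom \<Gamma> X h) \<and>
    (\<forall>h. is_natural_hom \<Gamma> X h \<longrightarrow> h \<in> Group.iso (VA (full_subgraph \<Gamma> X)) (VA_parabolic \<Gamma> X))"
proof -
  define \<Delta> where "\<Delta> = full_subgraph \<Gamma> X"
  let ?D = "va_gens \<Delta>" and ?RD = "va_rels \<Delta>" and ?G = "va_gens \<Gamma>" and ?RG = "va_rels \<Gamma>"
  let ?gen = "presented_gen ?G ?RG" and ?Y = "va_sigma \<Gamma> ` X \<union> va_tau \<Gamma> ` X"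
  have vert: "vertices \<Delta> = X" by (simp add: \<Delta>_def full_subgraph_def)
  have m: "cox_m \<Delta> = cox_m \<Gamma>" by (simp add: \<Delta>_def full_subgraph_def)
  have gens: "?D = SigmaGen ` X \<union> TauGen ` X" by (simp add: va_gens_def vert)
  have sub: "?D \<subseteq> ?G" unfolding gens using assms(2) by (auto simp: va_gens_def)
  then have words: "group_words ?D \<subseteq> group_words ?G" 
    unfolding group_words_def by (intro lists_mono Un_mono image_mono)
  interpret VG: group "VA \<Gamma>" by (rule group_VA)
  interpret VD: group "VA \<Delta>" by (rule group_VA)
  have rels: "va_relations \<Delta> \<subseteq> va_relations \<Gamma>"
  proof (rule subrelI)
    fix u v assume "(u, v) \<in> va_relations \<Delta>"
    then show "(u, v) \<in> va_relations \<Gamma>"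
    proof cases
      case (v1 s t k)
      then show ?thesis using assms(2) vert m by (auto intro: va_relations.v1)
    next
      case (v2_square s)
      then show ?thesis using assms(2) vert by (auto intro: va_relations.v2_square)
    next
      case (v2_braid s t k)
      then show ?thesis using assms(2) vert m by (auto intro: va_relations.v2_braid)
    next
      case (v3 s t k r)
      show ?thesis
        unfolding v3(1,2) by (rule va_relations.v3) (use v3 assms(2) vert m in auto)
    qed
  qed
  have genY: "?gen ` ?D = ?Y" unfolding gens by (rule va_gens_generators)
  have Y: "?Y \<subseteq> carrier (VA \<Gamma>)"
    using assms(2) va_sigma_in_VA[of _ \<Gamma>] va_tau_in_VA[of _ \<Gamma>] by blast
  have carrier: "carrier (VA_parabolic \<Gamma> X) = generate (VA \<Gamma>) ?Y"
    by (rule carrier_VA_parabolic[OF assms(2)])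
  have mult: "x \<otimes>\<^bsub>VA_parabolic \<Gamma> X\<^esub> y = x \<otimes>\<^bsub>VA \<Gamma>\<^esub> y" for x y
    by (simp add: VA_parabolic_def)
  interpret P: group "VA_parabolic \<Gamma> X"
    unfolding VA_parabolic_def by (rule VG.group_subgroup_generated)
  have "\<exists>h\<in>hom (VA \<Delta>) (VA_parabolic \<Gamma> X). \<forall>a\<in>?D. h (presented_gen ?D ?RD a) = ?gen a"
    unfolding VA_def[of \<Delta>]
  proof (rule presented_group_universal[OF va_rels_words P.is_group])
    show gen: "?gen ` ?D \<subseteq> carrier (VA_parabolic \<Gamma> X)"
      unfolding carrier genY by (rule generate.incl[THEN subsetI])
    fix u v assume "(u, v) \<in> ?RD"
    then obtain u' v' where u': "(u', v') \<in> va_relations \<Gamma>" "u = map Pos u'" "v = map Pos v'"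
      using rels by (auto simp: va_rels_def)
    \<comment> \<open>The subgroup inherits product and unit, and relations contain positive letters
      only, so they can be checked in \<open>VA \<Gamma>\<close>.\<close>
    have "word_prod (VA_parabolic \<Gamma> X) ?gen w = word_prod (VA \<Gamma>) ?gen w" for w
      by (induction w) (simp_all add: mult, simp add: VA_parabolic_def)
    then show "eval_word (VA_parabolic \<Gamma> X) ?gen u = eval_word (VA_parabolic \<Gamma> X) ?gen v"
      using VA_relation[OF u'(1)] by (simp add: u' eval_word_Pos)
  qed
  then have ex: "\<exists>h. is_natural_hom \<Gamma> X h"
    by (fastforce simp: is_natural_hom_def va_sigma_def va_tau_def gens simp flip: \<Delta>_def)
  \<comment> \<open>The values on the generators determine \<open>h\<close> on all classes, so an
    arbitrary natural homomorphism can be treated.\<close>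
  have "h \<in> Group.iso (VA \<Delta>) (VA_parabolic \<Gamma> X)" if h: "is_natural_hom \<Gamma> X h" for h
  proof -
    have hP: "h \<in> hom (VA \<Delta>) (VA_parabolic \<Gamma> X)"
      using h by (simp add: is_natural_hom_def \<Delta>_def)
    \<comment> \<open>With target \<open>VA \<Gamma>\<close>, images of generated subgroups are
      generated by the images, which gives surjectivity below.\<close>
    have hG: "h \<in> hom (VA \<Delta>) (VA \<Gamma>)"
      using hP VG.generate_incl[OF Y] by (auto simp: hom_def carrier mult)
    then interpret hG: group_hom "VA \<Delta>" "VA \<Gamma>" h
      by unfold_locales
    have h_gen: "h (presented_gen ?D ?RD a) = ?gen a" if "a \<in> ?D" for a
      using that h by (auto simp: gens is_natural_hom_def va_sigma_def va_tau_def simp flip: \<Delta>_def)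
    have gen_closed: "presented_gen ?D ?RD a \<in> carrier (VA \<Delta>)" if "a \<in> ?D" for a
      unfolding VA_def using that by (rule presented_gen_in_carrier)
    have h_eval: "h (eval_word (VA \<Delta>) (presented_gen ?D ?RD) w) = eval_word (VA \<Gamma>) ?gen w"
      if "w \<in> group_words ?D" for w
      using that
    proof (induction w)
      case (Cons l w)
      then show ?case
        using eval_word_closed[OF group_VA[of \<Delta>], of "presented_gen ?D ?RD" ?D w] gen_closed h_gen
        by (cases l) (auto simp: image_subset_iff)
    qed simp
    have h_class: "h (word_class ?D ?RD w) = word_class ?G ?RG w" if "w \<in> group_words ?D" for w
      using h_eval[OF that] eval_presented_gen[OF va_rels_words that]
        eval_presented_gen[OF va_rels_words subsetD[OF words that]]
      by (simp add: VA_def)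
    have "inj_on h (carrier (VA \<Delta>))"
    proof (rule inj_onI)
      fix a b assume "a \<in> carrier (VA \<Delta>)" "b \<in> carrier (VA \<Delta>)" and eq: "h a = h b"
      then obtain u v where uv: "u \<in> group_words ?D" "v \<in> group_words ?D"
        "a = word_class ?D ?RD u" "b = word_class ?D ?RD v"
        by (auto simp: VA_def carrier_presented_group)
      then have "(u, v) \<in> word_cong ?G ?RG"
        using eq words word_class_eq_iff[OF va_rels_words, of u \<Gamma> v] by (simp add: h_class subset_iff)
      then show "a = b"
        using VA_class_cong[OF assms] uv by (simp add: \<Delta>_def)
    qed
    moreover have "h ` carrier (VA \<Delta>) = carrier (VA_parabolic \<Gamma> X)"
    proof -
      have "carrier (VA \<Delta>) = generate (VA \<Delta>) (presented_gen ?D ?RD ` ?D)"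
        unfolding VA_def by (rule presented_group_generated[OF va_rels_words, symmetric])
      then have "h ` carrier (VA \<Delta>) = generate (VA \<Gamma>) (h ` presented_gen ?D ?RD ` ?D)"
        using hG.generate_img[of "presented_gen ?D ?RD ` ?D"] gen_closed by auto
      also have "h ` presented_gen ?D ?RD ` ?D = ?Y"
        unfolding genY[symmetric] image_image by (rule image_cong) (use h_gen in auto)
      finally show ?thesis by (simp add: carrier)
    qed
    ultimately show ?thesis
      using hP by (simp add: iso_def bij_betw_def)
  qed
  then show ?thesis using ex by (simp add: \<Delta>_def)
qed

end
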